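(* Let $K$ be a non-archimedean field of residue characteristic $p\geq 0$, and let $\phi\in K(z)$ be a rational function of degree $d\geq 2$ with a totally invariant type II point $\xi\in\mathbb{P}^1_{\mathrm{Berk}}$. Let $e=v_p(d-1)\geq 0$, and let $U$ be an indifferent fixed component of $\mathbb{P}^1_{\mathrm{Berk}}\setminus\{\xi\}$ such that $U\cap\mathbb{P}^1(K)\neq\varnothing$. Then there is a point $\alpha\in\mathbb{P}^1(\overline{K})\setminus U$ such that $[K(\alpha):K]\leq p^e$.
   Context: $K$ is a field, $\overline{K}$ an algebraic closure, $|\cdot|$ a non-archimedean absolute value on $\overline{K}$, $\mathbb{C}_v$ the completion of $\overline{K}$; $p$ is the residue characteristic of $K$. For prime $p$, $v_p(n)$ is the largest $e$ with $p^e\mid n$; if $p=0$, $v_p(n)=0$ and $p^0=1$. $\mathbb{P}^1_{\mathrm{Berk}}$ is the Berkovich projective line over $\mathbb{C}_v$, a compact Hausdorff uniquely path-connected space containing $\mathbb{P}^1(\mathbb{C}_v)$, with a point $\zeta(a,r)$ for each closed disk $\bar D(a,r)\subseteq\mathbb{C}_v$, type II when $r\in|\mathbb{C}_v^\times|$; the components of $\mathbb{P}^1_{\mathrm{Berk}}\setminus\{\zeta(a,r)\}$ meet $\mathbb{P}^1(\mathbb{C}_v)$ in $\mathbb{P}^1(\mathbb{C}_v)\setminus\bar D(a,r)$ and in the open disks $D(b,r)$, $b\in\bar D(a,r)$. Rational functions extend uniquely to continuous self-maps of $\mathbb{P}^1_{\mathrm{Berk}}$. $\xi$ is totally invariant if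 $\phi^{-1}(\xi)=\{\xi\}$. A component $U$ of $\mathbb{P}^1_{\mathrm{Berk}}\setminus\{\xi\}$ is fixed if $\phi(U)\subseteq U$; a fixed component is indifferent if $\phi:U\to U$ is one-to-one, attracting otherwise. For $\alpha=\infty$, $K(\alpha)=K$.
   Formalization: "One-to-one" is read with multiplicity: φ is injective on U and has multiplicity 1 at every classical point of U. With plain injectivity the claim fails for inseparable maps, e.g. φ = z^p + 1/t over F_p((t)) with U the component of ∞. *)

theory Defs
  imports "HOL-Analysis.Analysis" "HOL-Algebra.Algebraic_Closure_Type"
begin

section \<open>Non-archimedean fields\<close>

definition nonarch_absv :: "('a::field \<Rightarrow> real) \<Rightarrow> bool" where
  "nonarch_absv v \<longleftrightarrow>
     (\<forall>x. 0 \<le> v x) \<and> (\<forall>x. v x = 0 \<longleftrightarrow> x = 0) \<and>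
     (\<forall>x y. v (x * y) = v x * v y) \<and> (\<forall>x y. v (x + y) \<le> max (v x) (v y))"

text \<open>
  The characteristic of the residue field of the valuation ring {x. v x \<le> 1} modulo its
  maximal ideal {x. v x < 1}; this is the library definition of CHAR with "of_nat n is zero
  in the residue field" written out.
\<close>
definition residue_char :: "('a::field \<Rightarrow> real) \<Rightarrow> nat" where
  "residue_char v = Gcd {n. v (of_nat n) < 1}"

text \<open>The exponent of p in n; identically zero for p = 0, where p ^ 0 = 1 in nat.\<close>
definition vp :: "nat \<Rightarrow> nat \<Rightarrow> nat" where
  "vp p n = (if p = 0 then 0 else multiplicity p n)"

text \<open>
  The field (C, w) together with the embedding \<iota> is a completion of the field (L, v).
\<close>
definition is_completion ::
    "('l::field \<Rightarrow> real) \<Rightarrow> ('c::field \<Rightarrow> real) \<Rightarrow> ('l \<Rightarrow> 'c) \<Rightarrow> bool" where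
  "is_completion v w \<iota> \<longleftrightarrow>
     nonarch_absv w \<and>
     \<iota> 1 = 1 \<and> (\<forall>x y. \<iota> (x + y) = \<iota> x + \<iota> y) \<and> (\<forall>x y. \<iota> (x * y) = \<iota> x * \<iota> y) \<and>
     (\<forall>x. w (\<iota> x) = v x) \<and>
     Metric_space.mcomplete UNIV (\<lambda>x y. w (x - y)) \<and>
     Metric_space.mtopology UNIV (\<lambda>x y. w (x - y)) closure_of range \<iota> = UNIV"

section \<open>The degree of \<open>K(\<alpha>)\<close> over \<open>K\<close>\<close>

definition is_subfield :: "'a::field set \<Rightarrow> bool" where
  "is_subfield F \<longleftrightarrow> 0 \<in> F \<and> 1 \<in> F \<and>
     (\<forall>x\<in>F. \<forall>y\<in>F. x + y \<in> F \<and> x * y \<in> F) \<and> (\<forall>x\<in>F. - x \<in> F \<and> inverse x \<in> F)"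

text \<open>
  Throughout, a point of the projective line over a field is an option value, None being
  the point at infinity. In particular K(\<infinity>) = K.
\<close>
definition adjoin :: "'k::field alg_closure option \<Rightarrow> 'k alg_closure set" where
  "adjoin \<alpha> = is_subfield hull (range to_ac \<union> set_option \<alpha>)"

definition ext_degree :: "'k::field alg_closure option \<Rightarrow> nat" where
  "ext_degree \<alpha> = vector_space.dim (\<lambda>(c::'k) x. to_ac c * x) (adjoin \<alpha>)"

section \<open>Rational functions\<close>

text \<open>
  A rational function is given by a pair of coprime polynomials P, Q as P / Q.
\<close>
definition rat_degree :: "'a::field poly \<Rightarrow> 'a poly \<Rightarrow> nat" where
  "rat_degree P Q = max (Polynomial.degree P) (Polynomial.degree Q)"

fun rat_map :: "'a::field poly \<Rightarrow> 'a poly \<Rightarrow> 'a option \<Rightarrow> 'a option" where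
  "rat_map P Q (Some a) = (if poly Q a = 0 then None else Some (poly P a / poly Q a))"
| "rat_map P Q None =
     (if Polynomial.degree P > Polynomial.degree Q then None
      else Some (Polynomial.coeff P (Polynomial.degree Q) / Polynomial.coeff Q (Polynomial.degree Q)))"

text \<open>
  The zeros of \<open>fibre_poly P Q b\<close>, viewed as a form of degree \<open>rat_degree P Q\<close>, are the
  preimages of b under P / Q; multiplicity at infinity is the drop in degree.
\<close>
fun fibre_poly :: "'a::field poly \<Rightarrow> 'a poly \<Rightarrow> 'a option \<Rightarrow> 'a poly" where
  "fibre_poly P Q (Some b) = P - Polynomial.smult b Q"
| "fibre_poly P Q None = Q"

definition rat_mult :: "'a::field poly \<Rightarrow> 'a poly \<Rightarrow> 'a option \<Rightarrow> nat" where
  "rat_mult P Q a =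
     (let F = fibre_poly P Q (rat_map P Q a)
      in case a of None \<Rightarrow> rat_degree P Q - Polynomial.degree F | Some c \<Rightarrow> Polynomial.order c F)"

section \<open>The Berkovich projective line\<close>

text \<open>Multiplicative seminorms on C[z] extending the absolute value w of C.\<close>
definition mult_seminorm :: "('c::field \<Rightarrow> real) \<Rightarrow> ('c poly \<Rightarrow> real) \<Rightarrow> bool" where
  "mult_seminorm w x \<longleftrightarrow>
     (\<forall>f. 0 \<le> x f) \<and> (\<forall>f g. x (f + g) \<le> x f + x g) \<and> (\<forall>f g. x (f * g) = x f * x g) \<and>
     (\<forall>c. x [:c:] = w c)"

text \<open>
  The Berkovich affine line with the coarsest topology making all evaluations
  \<open>x \<mapsto> x f\<close> continuous, and its one-point compactification.
\<close>
definition berk_A1 :: "('c::field \<Rightarrow> real) \<Rightarrow> ('c poly \<Rightarrow> real) topology" where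
  "berk_A1 w = subtopology (product_topology (\<lambda>_. euclideanreal) UNIV) {x. mult_seminorm w x}"

definition berk_P1 :: "('c::field \<Rightarrow> real) \<Rightarrow> ('c poly \<Rightarrow> real) option topology" where
  "berk_P1 w = Alexandroff_compactification (berk_A1 w)"

definition type1 :: "('c::field \<Rightarrow> real) \<Rightarrow> 'c option \<Rightarrow> ('c poly \<Rightarrow> real) option" where
  "type1 w = map_option (\<lambda>a f. w (poly f a))"

definition zeta :: "('c::field \<Rightarrow> real) \<Rightarrow> 'c \<Rightarrow> real \<Rightarrow> ('c poly \<Rightarrow> real) option" where
  "zeta w a r = Some (\<lambda>f. SUP z\<in>{z. w (z - a) \<le> r}. w (poly f z))"

definition type_II :: "('c::field \<Rightarrow> real) \<Rightarrow> ('c poly \<Rightarrow> real) option \<Rightarrow> bool" where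
  "type_II w \<xi> \<longleftrightarrow> (\<exists>a. \<exists>r \<in> w ` (UNIV - {0}). \<xi> = zeta w a r)"

text \<open>\<open>homog_subst P Q f\<close> is \<open>f(P/Q) * Q ^ degree f\<close>.\<close>
definition homog_subst :: "'c::field poly \<Rightarrow> 'c poly \<Rightarrow> 'c poly \<Rightarrow> 'c poly" where
  "homog_subst P Q f =
     (\<Sum>i\<le>Polynomial.degree f. Polynomial.smult (Polynomial.coeff f i) (P ^ i * Q ^ (Polynomial.degree f - i)))"

text \<open>
  The extension of \<open>\<phi> = P/Q\<close> to the Berkovich line: \<open>\<phi>(x)\<close> is the seminorm \<open>f \<mapsto> x (f \<circ> \<phi>)\<close>,
  where x is extended multiplicatively to fractions, and it is infinity if \<open>x Q = 0\<close>.
\<close>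
fun berk_map :: "('c::field \<Rightarrow> real) \<Rightarrow> 'c poly \<Rightarrow> 'c poly \<Rightarrow>
    ('c poly \<Rightarrow> real) option \<Rightarrow> ('c poly \<Rightarrow> real) option" where
  "berk_map w P Q None = type1 w (rat_map P Q None)"
| "berk_map w P Q (Some x) =
     (if x Q = 0 then None
      else Some (\<lambda>f. x (homog_subst P Q f) / x Q ^ Polynomial.degree f))"

lemma berk_map_type1:
  assumes w: "nonarch_absv w"
  shows "berk_map w P Q (type1 w a) = type1 w (rat_map P Q a)"
proof (cases a)
  case None
  then show ?thesis by (simp add: type1_def)
next
  case (Some c)
  have w0: "w x = 0 \<longleftrightarrow> x = 0" and wm: "w (x * y) = w x * w y" for x y
    using w by (auto simp: nonarch_absv_def)
  have w1: "w 1 = 1"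
    using wm[of 1 1] w0[of 1] by simp
  have wp: "w (x ^ n) = w x ^ n" for x n
    by (induction n) (auto simp: w1 wm)
  have wd: "w (x / y) = w x / w y" if "y \<noteq> 0" for x y
    using wm[of "x / y" y] that w0[of y] by (simp add: field_simps)
  have hs: "poly (homog_subst P Q f) c = poly f (poly P c / poly Q c) * poly Q c ^ Polynomial.degree f"
    if "poly Q c \<noteq> 0" for f
  proof -
    have "Polynomial.coeff f i * (poly P c ^ i * poly Q c ^ (Polynomial.degree f - i)) =
        Polynomial.coeff f i * (poly P c / poly Q c) ^ i * poly Q c ^ Polynomial.degree f"
      if "i \<le> Polynomial.degree f" for i
    proof -
      have "poly Q c ^ Polynomial.degree f = poly Q c ^ i * poly Q c ^ (Polynomial.degree f - i)"
        using that by (simp flip: power_add)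
      with \<open>poly Q c \<noteq> 0\<close> show ?thesis by (simp add: power_divide)
    qed
    then show ?thesis
      unfolding homog_subst_def poly_altdef[of f] sum_distrib_right poly_sum
      by (intro sum.cong refl) (simp only: poly_smult poly_mult poly_power atMost_iff)
  qed
  then show ?thesis
    using Some by (auto simp: type1_def fun_eq_iff w0 wm wp hs)
qed

section \<open>Dynamics\<close>

definition totally_invariant ::
    "('c::field \<Rightarrow> real) \<Rightarrow> 'c poly \<Rightarrow> 'c poly \<Rightarrow> ('c poly \<Rightarrow> real) option \<Rightarrow> bool" where
  "totally_invariant w P Q \<xi> \<longleftrightarrow> {x \<in> topspace (berk_P1 w). berk_map w P Q x = \<xi>} = {\<xi>}"

definition fixed_component ::
    "('c::field \<Rightarrow> real) \<Rightarrow> 'c poly \<Rightarrow> 'c poly \<Rightarrow> ('c poly \<Rightarrow> real) option \<Rightarrow>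
     ('c poly \<Rightarrow> real) option set \<Rightarrow> bool" where
  "fixed_component w P Q \<xi> U \<longleftrightarrow>
     U \<in> connected_components_of (subtopology (berk_P1 w) (topspace (berk_P1 w) - {\<xi>})) \<and>
     berk_map w P Q ` U \<subseteq> U"

text \<open>
  One-to-one is meant with multiplicity: injective on U, and of multiplicity one at every
  classical point of U. For separable P / Q over a nontrivially valued field (and U a
  component of the complement of a totally invariant point) the second condition follows from
  the first. It excludes inseparable maps: in characteristic p the map \<open>z \<mapsto> z ^ p\<close>
  is injective on the whole Berkovich line although it has degree p on each component.
\<close>
definition indifferent_component ::
    "('c::field \<Rightarrow> real) \<Rightarrow> 'c poly \<Rightarrow> 'c poly \<Rightarrow> ('c poly \<Rightarrow> real) option \<Rightarrow>
     ('c poly \<Rightarrow> real) option set \<Rightarrow> bool" where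
  "indifferent_component w P Q \<xi> U \<longleftrightarrow>
     fixed_component w P Q \<xi> U \<and> inj_on (berk_map w P Q) U \<and>
     (\<forall>a. type1 w a \<in> U \<longrightarrow> rat_mult P Q a = 1)"

end

(*
  Let a be a K-rational point of U and consider the fibre of phi over phi(a). Since phi is
  injective on U and has multiplicity 1 at a, the other d - 1 points of this fibre, counted with
  multiplicity, lie outside U. In a coordinate u over K with a at infinity, the complement of U is
  a closed disk, and these d - 1 points are the roots of a polynomial G over K of degree
  n = d - 1. Put q = p^e. The Hasse derivative of G of order n - q has degree q, because its
  leading coefficient is that of G times the binomial coefficient (n choose q), which has absolute
  value 1. Hence, by the ultrametric estimate for the coefficients in terms of the roots, all its roots
  lie in the same disk as those of G, and each of them generates an extension of degree at most q.
*)

theory Submission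
  imports Defs "HOL-Algebra.Exponent"
begin

section \<open>Non-archimedean absolute values\<close>

text \<open>For p > 0 the number q = p^e is the least positive q for which (n choose q) is prime to
  p, by Lucas's theorem; for p = 0 it is 1. This is where the bound comes from: a Hasse derivative
  keeps a leading coefficient of full size only if that binomial is a unit, and q is the smallest
  degree for which this happens. The other half of the work is to find the disk. U is given as a
  connected component in a space of seminorms, whereas the estimate is about classical points. That
  U fills its disk follows from paths of Gauss norms avoiding \<xi>. That U does not exceed it
  follows from two open sets separating the disk from everything else but \<xi>; for this, a
  seminorm with the values of \<xi> on all linear polynomials has to be \<xi> itself. Splitting into
  linear factors takes place over the algebraic closure of K, which is dense in its completion, and
  is carried over by approximating coefficients. For the same reason centres of disks are moved into
  that closure before roots are sought there.\<close>

locale nonarch_field =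
  fixes w :: "'a::field \<Rightarrow> real"
  assumes nonarch: "nonarch_absv w"
begin

lemma nonneg [simp]: "0 \<le> w x"
  and eq_0_iff [simp]: "w x = 0 \<longleftrightarrow> x = 0"
  and mult: "w (x * y) = w x * w y"
  and add_le: "w (x + y) \<le> max (w x) (w y)"
  using nonarch by (auto simp: nonarch_absv_def)

lemma zero [simp]: "w 0 = 0"
  by simp

lemma pos_iff [simp]: "0 < w x \<longleftrightarrow> x \<noteq> 0"
  using nonneg[of x] eq_0_iff[of x] by linarith

lemma le_0_iff [simp]: "w x \<le> 0 \<longleftrightarrow> x = 0"
  using pos_iff[of x] by linarith

lemma one [simp]: "w 1 = 1"
  using mult[of 1 1] by simp

lemma power: "w (x ^ n) = w x ^ n"
  by (induction n) (auto simp: mult)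

lemma inverse: "w (inverse x) = inverse (w x)"
proof (cases "x = 0")
  case False
  then have "w x * w (inverse x) = 1"
    by (simp flip: mult)
  then show ?thesis
    using False by (simp add: field_simps)
qed auto

lemma divide: "w (x / y) = w x / w y"
  by (simp add: field_class.field_divide_inverse mult inverse)

lemma uminus [simp]: "w (- x) = w x"
proof -
  have "w (-1) * w (-1) = 1"
    by (simp flip: mult)
  then have "(w (-1) - 1) * (w (-1) + 1) = 0"
    by (simp add: algebra_simps)
  then have "w (-1) = 1"
    using nonneg[of "-1"] by (simp only: mult_eq_0_iff) linarith
  then show ?thesis
    using mult[of "-1" x] by simp
qed

lemma minus_commute: "w (x - y) = w (y - x)"
  using uminus[of "x - y"] by simp

lemma diff_le: "w (x - y) \<le> max (w x) (w y)"
  using add_le[of x "- y"] by simp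

lemma sum_le:
  assumes "\<And>i. i \<in> A \<Longrightarrow> w (f i) \<le> B" and "0 \<le> B"
  shows "w (\<Sum>i\<in>A. f i) \<le> B"
  using assms
proof (induction A rule: infinite_finite_induct)
  case (insert x A)
  then have "w (f x) \<le> B" "w (sum f A) \<le> B" by auto
  then show ?case
    using insert.hyps add_le[of "f x" "sum f A"] by (auto simp: max_def split: if_splits)
qed auto

lemma sum_less:
  assumes "\<And>i. i \<in> A \<Longrightarrow> w (f i) < B" and "0 < B"
  shows "w (\<Sum>i\<in>A. f i) < B"
  using assms
proof (induction A rule: infinite_finite_induct)
  case (insert x A)
  then have "w (f x) < B" "w (sum f A) < B" by auto
  then show ?case
    using insert.hyps add_le[of "f x" "sum f A"] by (auto simp: max_def split: if_splits)
qed auto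

lemma add_eq_if_less:
  assumes "w x < w y"
  shows "w (x + y) = w y"
  using add_le[of x y] diff_le[of "x + y" x] assms by (simp add: max_def split: if_splits)

section \<open>Integers in the valuation ring and the residue characteristic\<close>

lemma of_nat_le_1: "w (of_nat n) \<le> 1"
proof (induction n)
  case (Suc n)
  then show ?case
    using add_le[of 1 "of_nat n"] by simp
qed auto

text \<open>Closure under remainders makes the natural numbers of absolute value below 1 the
  multiples of their least positive member, if there is one.\<close>

lemma of_nat_less_1_mod:
  assumes "w (of_nat n) < 1" "w (of_nat l) < 1"
  shows "w (of_nat (n mod l)) < 1"
proof -
  have "(of_nat (n mod l) :: 'a) = of_nat n - of_nat l * of_nat (n div l)"
    by (metis add_diff_cancel_left' mult_div_mod_eq of_nat_add of_nat_mult)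
  moreover have "w (of_nat l * of_nat (n div l)) < 1"
    using assms(2) of_nat_le_1[of "n div l"] mult_right_mono[of "w (of_nat (n div l))" 1 "w (of_nat l)"]
    by (simp add: mult mult.commute)
  ultimately show ?thesis
    using assms(1) diff_le[of "of_nat n" "of_nat l * of_nat (n div l)"] by simp
qed

lemma of_nat_less_1_iff: "w (of_nat n) < 1 \<longleftrightarrow> residue_char w dvd n"
proof -
  define I where "I = {n. w (of_nat n) < 1}"
  define l where "l = Gcd I"
  \<comment> \<open>The content is that a gcd of the set lies in the set: it is the least positive
    member, or 0 if there is none.\<close>
  have "l \<in> I"
  proof (cases "\<exists>m\<in>I. m > 0")
    case True
    define m where "m = (LEAST m. m \<in> I \<and> m > 0)"
    have m: "m \<in> I \<and> m > 0"
      unfolding m_def by (rule LeastI_ex) (use True in auto)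
    have "m dvd k" if "k \<in> I" for k
    proof (rule ccontr)
      assume "\<not> m dvd k"
      then have "k mod m > 0" by (simp add: mod_greater_zero_iff_not_dvd)
      moreover have "k mod m \<in> I"
        using of_nat_less_1_mod that m by (auto simp: I_def)
      ultimately have "m \<le> k mod m"
        unfolding m_def by (intro Least_le) auto
      then show False
        using m mod_less_divisor[of m k] by linarith
    qed
    then have "m dvd l" "l dvd m"
      using m by (auto simp: l_def intro: Gcd_greatest Gcd_dvd)
    then show ?thesis
      using m dvd_antisym by metis
  next
    case False
    then have "I \<subseteq> {0}" by auto
    then have "l = 0" by (auto simp: l_def Gcd_0_iff)
    then show ?thesis by (simp add: I_def)
  qed
  moreover have "residue_char w = l"
    by (simp add: l_def I_def residue_char_def)
  moreover have "w (of_nat n) < 1" if "l \<in> I" "l dvd n"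
  proof -
    obtain k where "n = l * k" using \<open>l dvd n\<close> by auto
    then show ?thesis
      using \<open>l \<in> I\<close> of_nat_le_1[of k] mult_right_mono[of "w (of_nat k)" 1 "w (of_nat l)"]
      by (simp add: mult mult.commute I_def)
  qed
  ultimately show ?thesis
    by (auto simp: l_def I_def intro: Gcd_dvd)
qed

text \<open>The maximal ideal of the valuation ring is prime: a product of two integers of absolute
  value 1 has absolute value 1.\<close>

lemma residue_char_0_or_prime: "residue_char w = 0 \<or> Factorial_Ring.prime (residue_char w)"
proof (cases "residue_char w = 0")
  case False
  let ?p = "residue_char w"
  have "w (of_nat 1) = 1" by simp
  then have 1: "\<not> ?p dvd 1"
    using of_nat_less_1_iff[of 1] by auto
  have 2: "?p dvd a \<or> ?p dvd b" if "?p dvd a * b" for a b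
  proof (rule ccontr)
    assume "\<not> ?thesis"
    then have "w (of_nat a) = 1" "w (of_nat b) = 1"
      using of_nat_less_1_iff[of a] of_nat_less_1_iff[of b] of_nat_le_1[of a] of_nat_le_1[of b]
      by auto
    then show False
      using that by (simp add: mult flip: of_nat_less_1_iff)
  qed
  have "prime_elem ?p"
    using False 1 2 by (rule prime_elemI)
  then show ?thesis by simp
qed auto

text \<open>For p > 0 write n = q m with p not dividing m; then (n choose q) and m have the same
  p-adic valuation. For p = 0 the binomial is n itself, and only 0 has absolute value below
  1.\<close>

lemma of_nat_binomial_eq_1:
  assumes "n > 0"
  shows "w (of_nat (n choose (residue_char w ^ vp (residue_char w) n))) = 1"
    and "residue_char w ^ vp (residue_char w) n > 0"
    and "residue_char w ^ vp (residue_char w) n \<le> n"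
proof -
  let ?p = "residue_char w" and ?q = "residue_char w ^ vp (residue_char w) n"
  have "\<not> ?p dvd n choose ?q \<and> ?q > 0 \<and> ?q \<le> n"
  proof (cases "?p = 0")
    case True
    then show ?thesis
      using assms by (auto simp: vp_def)
  next
    case False
    then have p: "Factorial_Ring.prime ?p"
      using residue_char_0_or_prime by auto
    define e where "e = multiplicity ?p n"
    obtain m where m: "n = ?p ^ e * m" "\<not> ?p dvd m"
      using multiplicity_decompose'[of n ?p] assms p unfolding e_def
      by (metis not_prime_unit not_gr_zero)
    then have "multiplicity ?p (n choose ?p ^ e) = multiplicity ?p m"
      using assms p const_p_fac by (metis gr0I mult_0_right)
    also have "\<dots> = 0"
      using m by (simp add: not_dvd_imp_multiplicity_0)
    \<comment> \<open>\<open>multiplicity\<close> is 0 also at 0, so the second alternative has to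
      be excluded, by q \<le> n.\<close>
    finally have "\<not> ?p dvd n choose ?p ^ e \<or> n choose ?p ^ e = 0"
      using p by (metis multiplicity_eq_zero_iff not_prime_unit)
    moreover have "?p ^ e \<le> n"
      using m assms by (metis dvd_imp_le dvd_triv_left)
    ultimately show ?thesis
      using False by (auto simp: vp_def e_def)
  qed
  then show "w (of_nat (n choose ?q)) = 1" "?q > 0" "?q \<le> n"
    using of_nat_less_1_iff[of "n choose ?q"] of_nat_le_1[of "n choose ?q"] by auto
qed

end

section \<open>Hasse derivatives\<close>

text \<open>The Taylor coefficients of f: f(z + t) is the sum of the \<open>hasse k f\<close> times
  t^k. This is the k-th derivative over k!, formed without a division that may be by 0.\<close>

definition hasse :: "nat \<Rightarrow> 'a::comm_ring_1 poly \<Rightarrow> 'a poly" where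
  "hasse k f = (\<Sum>i\<le>Polynomial.degree f - k. Polynomial.monom (of_nat (i + k choose k) * Polynomial.coeff f (i + k)) i)"

lemma coeff_hasse: "Polynomial.coeff (hasse k f) i = of_nat (i + k choose k) * Polynomial.coeff f (i + k)"
proof (cases "i \<le> Polynomial.degree f - k")
  case True
  then show ?thesis by (simp add: hasse_def coeff_sum_monom)
next
  case False
  then have "Polynomial.coeff f (i + k) = 0"
    by (intro coeff_eq_0) linarith
  then show ?thesis
    using False by (simp add: hasse_def coeff_sum)
qed

lemma degree_hasse_le: "Polynomial.degree (hasse k f) \<le> Polynomial.degree f - k"
  by (intro degree_le) (auto simp: coeff_hasse coeff_eq_0)

lemma hasse_0_left [simp]: "hasse 0 f = f"
  by (auto simp: poly_eq_iff coeff_hasse)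

lemma hasse_0_right [simp]: "hasse k 0 = 0"
  by (auto simp: poly_eq_iff coeff_hasse)

lemma hasse_add: "hasse k (f + g) = hasse k f + hasse k g"
  by (auto simp: poly_eq_iff coeff_hasse algebra_simps)

lemma hasse_const: "k > 0 \<Longrightarrow> hasse k [:c:] = 0"
  by (auto simp: poly_eq_iff coeff_hasse coeff_pCons split: nat.splits)

text \<open>The Leibniz rule for a factor of degree 1, whose Hasse derivatives beyond order 1
  vanish; on coefficients it is Pascal's rule.\<close>

lemma hasse_linear_mult:
  "hasse (Suc k) ([:c, 1:] * f) = [:c, 1:] * hasse (Suc k) f + hasse k f"
proof (rule poly_eqI)
  fix i
  show "Polynomial.coeff (hasse (Suc k) ([:c, 1:] * f)) i =
      Polynomial.coeff ([:c, 1:] * hasse (Suc k) f + hasse k f) i"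
    by (cases i) (auto simp: coeff_hasse algebra_simps)
qed

text \<open>Translation invariance allows the estimate to be made around the centre of the disk,
  which need not lie in K, while the derivative is taken over K.\<close>

lemma hasse_pcompose:
  "hasse k (pcompose f [:c, 1:]) = pcompose (hasse k f) [:c, 1:]"
proof (induction f arbitrary: k)
  case (pCons a f)
  have *: "pCons a f = [:a:] + [:0, 1:] * f" by simp
  show ?case
  proof (cases k)
    case (Suc j)
    have "hasse k (pcompose (pCons a f) [:c, 1:]) = hasse (Suc j) ([:c, 1:] * pcompose f [:c, 1:])"
      by (simp add: pcompose_pCons Suc hasse_add hasse_const del: mult_pCons_left)
    also have "\<dots> = [:c, 1:] * pcompose (hasse (Suc j) f) [:c, 1:] + pcompose (hasse j f) [:c, 1:]"
      by (simp only: hasse_linear_mult pCons)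
    also have "\<dots> = pcompose ([:0, 1:] * hasse (Suc j) f + hasse j f) [:c, 1:]"
      by (simp only: pcompose_add pcompose_mult) (simp add: pcompose_pCons)
    also have "[:0, 1:] * hasse (Suc j) f + hasse j f = hasse (Suc j) ([:0, 1:] * f)"
      by (simp only: hasse_linear_mult)
    also have "\<dots> = hasse k (pCons a f)"
      unfolding * by (simp add: hasse_add hasse_const Suc del: mult_pCons_left)
    finally show ?thesis .
  qed auto
qed auto

section \<open>Field embeddings\<close>

text \<open>Applied to the inclusion of K in its algebraic closure, to that of the closure in C, and
  to their composite.\<close>

locale field_embedding =
  fixes h :: "'a::field \<Rightarrow> 'b::field"
  assumes h_one [simp]: "h 1 = 1"
    and h_add: "h (x + y) = h x + h y"
    and h_mult: "h (x * y) = h x * h y"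
begin

lemma h_zero [simp]: "h 0 = 0"
proof -
  have "h 0 + h 0 = h 0 + 0"
    by (simp flip: h_add)
  then show ?thesis by (rule add_left_imp_eq)
qed

lemma h_uminus: "h (- x) = - h x"
  using h_add[of x "- x"] by (simp add: eq_neg_iff_add_eq_0 add.commute)

lemma h_diff: "h (x - y) = h x - h y"
  using h_add[of x "- y"] by (simp add: h_uminus)

lemma h_eq_0_iff [simp]: "h x = 0 \<longleftrightarrow> x = 0"
  using h_mult[of x "inverse x"] by (cases "x = 0") auto

lemma h_eq_iff [simp]: "h x = h y \<longleftrightarrow> x = y"
  using h_diff[of x y] by auto

lemma h_inverse: "h (inverse x) = inverse (h x)"
proof (cases "x = 0")
  case False
  then have "h x * h (inverse x) = 1" by (simp flip: h_mult)
  then show ?thesis by (rule inverse_unique[symmetric])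
qed auto

lemma h_divide: "h (x / y) = h x / h y"
  by (simp add: field_class.field_divide_inverse h_mult h_inverse)

lemma h_sum: "h (sum f A) = (\<Sum>x\<in>A. h (f x))"
  by (induction A rule: infinite_finite_induct) (auto simp: h_add)

lemma h_of_nat: "h (of_nat n) = of_nat n"
  by (induction n) (auto simp: h_add)

lemma coeff_map [simp]: "Polynomial.coeff (map_poly h f) i = h (Polynomial.coeff f i)"
  by (simp add: coeff_map_poly)

lemma degree_map [simp]: "Polynomial.degree (map_poly h f) = Polynomial.degree f"
  by (rule degree_map_poly) auto

lemma map_eq_0_iff [simp]: "map_poly h f = 0 \<longleftrightarrow> f = 0"
  by (auto simp: poly_eq_iff)

lemma map_add: "map_poly h (f + g) = map_poly h f + map_poly h g"
  by (auto simp: poly_eq_iff h_add)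

lemma map_diff: "map_poly h (f - g) = map_poly h f - map_poly h g"
  by (auto simp: poly_eq_iff h_diff)

lemma map_smult: "map_poly h (Polynomial.smult c f) = Polynomial.smult (h c) (map_poly h f)"
  by (auto simp: poly_eq_iff h_mult)

lemma map_mult: "map_poly h (f * g) = map_poly h f * map_poly h g"
  by (auto simp: poly_eq_iff h_mult coeff_mult h_sum)

lemma map_pCons [simp]: "map_poly h (pCons c f) = pCons (h c) (map_poly h f)"
  by (simp add: map_poly_pCons)

lemma poly_map: "poly (map_poly h f) (h x) = h (poly f x)"
  by (induction f) (auto simp: h_add h_mult)

lemma map_pcompose: "map_poly h (pcompose f g) = pcompose (map_poly h f) (map_poly h g)"
  by (induction f) (auto simp: pcompose_pCons map_add map_mult)

lemma map_reflect: "map_poly h (reflect_poly f) = reflect_poly (map_poly h f)"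
  by (auto simp: poly_eq_iff coeff_reflect_poly)

lemma map_monom: "map_poly h (Polynomial.monom c n) = Polynomial.monom (h c) n"
  by (simp add: map_poly_monom)

lemma map_hasse: "map_poly h (hasse k f) = hasse k (map_poly h f)"
  by (auto simp: poly_eq_iff coeff_hasse h_mult h_of_nat)

end

interpretation to_ac: field_embedding "to_ac :: 'k::field \<Rightarrow> 'k alg_closure"
  by standard auto

section \<open>Roots of Hasse derivatives in a disk\<close>

context nonarch_field
begin

lemma degree_prod_linear:
  "Polynomial.degree (\<Prod>x\<in>#A. [:- x, 1:]) = size (A :: 'a multiset)"
proof (induction A)
  case (add x A)
  have "(\<Prod>x\<in>#A. [:- x, 1:]) \<noteq> 0"
    by (auto simp: prod_mset_zero_iff)
  with add show ?case
    by (simp add: degree_mult_eq del: mult_pCons_left)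
qed auto

text \<open>Up to sign the coefficient is an elementary symmetric function of the roots, a sum of
  products of \<open>size A - i\<close> of them.\<close>

lemma coeff_le_of_roots_le:
  assumes "\<And>x. x \<in># A \<Longrightarrow> w x \<le> \<rho>" and "0 \<le> \<rho>" and "i \<le> size A"
  shows "w (Polynomial.coeff (\<Prod>x\<in>#A. [:- x, 1:]) i) \<le> \<rho> ^ (size A - i)"
  using assms
proof (induction A arbitrary: i)
  case empty
  then show ?case by simp
next
  case (add x A)
  let ?f = "\<Prod>x\<in>#A. [:- x, 1:]"
  note deg = degree_prod_linear[of A]
  have 1: "w (x * Polynomial.coeff ?f i) \<le> \<rho> ^ (Suc (size A) - i)"
  proof (cases "i \<le> size A")
    case True
    have "w x * w (Polynomial.coeff ?f i) \<le> \<rho> * \<rho> ^ (size A - i)"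
      by (intro mult_mono add.IH) (use add.prems True in auto)
    then show ?thesis
      using True by (simp add: mult Suc_diff_le)
  next
    case False
    then show ?thesis using deg \<open>0 \<le> \<rho>\<close> by (simp add: coeff_eq_0)
  qed
  have 2: "w (Polynomial.coeff ?f (i - 1)) \<le> \<rho> ^ (Suc (size A) - i)" if "i > 0"
    using add.IH[of "i - 1"] add.prems that by auto
  show ?case
  proof (cases i)
    case 0
    then show ?thesis using 1 by simp
  next
    case (Suc j)
    then show ?thesis
      using 1 2 diff_le[of "Polynomial.coeff ?f j" "x * Polynomial.coeff ?f i"]
      by (auto simp: algebra_simps)
  qed
qed

text \<open>At a point y outside the disk the leading term would be strictly larger than every other
  term, so nothing could cancel it.\<close>

lemma root_le_of_coeff_le:
  assumes f: "f \<noteq> 0"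
    and c: "\<And>i. i < Polynomial.degree f \<Longrightarrow>
      w (Polynomial.coeff f i) \<le> w (Polynomial.lead_coeff f) * \<rho> ^ (Polynomial.degree f - i)"
    and "0 \<le> \<rho>" and root: "poly f y = 0"
  shows "w y \<le> \<rho>"
proof (rule ccontr)
  assume "\<not> w y \<le> \<rho>"
  then have y: "\<rho> < w y" by simp
  then have "0 < w y" using \<open>0 \<le> \<rho>\<close> by linarith
  let ?n = "Polynomial.degree f"
  have "w (\<Sum>i<?n. Polynomial.coeff f i * y ^ i) < w (Polynomial.lead_coeff f) * w y ^ ?n"
  proof (rule sum_less)
    fix i assume "i \<in> {..<?n}"
    then have i: "i < ?n" by simp
    have "w (Polynomial.coeff f i * y ^ i) \<le> w (Polynomial.lead_coeff f) * \<rho> ^ (?n - i) * w y ^ i"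
      using c[OF i] by (simp add: mult power mult_right_mono)
    also have "\<dots> < w (Polynomial.lead_coeff f) * w y ^ (?n - i) * w y ^ i"
      using f y i \<open>0 \<le> \<rho>\<close> zero_less_power[OF \<open>0 < w y\<close>, of i]
      by (intro mult_strict_right_mono mult_strict_left_mono power_strict_mono) auto
    also have "\<dots> = w (Polynomial.lead_coeff f) * w y ^ ?n"
      using i by (simp flip: power_add)
    finally show "w (Polynomial.coeff f i * y ^ i) < w (Polynomial.lead_coeff f) * w y ^ ?n" .
  next
    show "0 < w (Polynomial.lead_coeff f) * w y ^ ?n"
      using f zero_less_power[OF \<open>0 < w y\<close>, of ?n] by simp
  qed
  then have "w (poly f y) = w (Polynomial.lead_coeff f) * w y ^ ?n"
    using add_eq_if_less[of "\<Sum>i<?n. Polynomial.coeff f i * y ^ i" "Polynomial.lead_coeff f * y ^ ?n"]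
    by (simp add: poly_altdef mult power flip: lessThan_Suc_atMost)
  then show False
    using root f y \<open>0 \<le> \<rho>\<close> by simp
qed

end

text \<open>The polynomial \<open>H\<close> is returned with its root so that the degree bound
  survives a later change of coordinate over K.\<close>

lemma exists_root_in_disk:
  fixes v :: "'k::field alg_closure \<Rightarrow> real" and G :: "'k poly"
  assumes v: "nonarch_absv v"
    and p: "p = residue_char (\<lambda>x::'k. v (to_ac x))"
    and n: "n = Polynomial.degree G" "n > 0"
    and roots: "\<And>u. poly (map_poly to_ac G) u = 0 \<Longrightarrow> v (u - \<beta>) \<le> \<rho>"
  shows "\<exists>u H. v (u - \<beta>) \<le> \<rho> \<and> H \<noteq> 0 \<and> Polynomial.degree H \<le> p ^ vp p n \<and>
    poly (map_poly to_ac (H :: 'k poly)) u = 0"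
proof -
  interpret nonarch_field v by standard (rule v)
  have p': "p = residue_char v"
    by (simp add: p residue_char_def)
  define q where "q = p ^ vp p n"
  have q: "v (of_nat (n choose q)) = 1" "q > 0" "q \<le> n"
    using of_nat_binomial_eq_1[of n] n by (auto simp: q_def p')
  \<comment> \<open>\<open>E\<close> is \<open>G\<close> recentred at \<beta>. Its coefficients need
    not lie in K, which is why \<open>H\<close> below is derived from \<open>G\<close> and only
    \<open>HE\<close> from \<open>E\<close>.\<close>
  define E where "E = pcompose (map_poly to_ac G) [:\<beta>, 1:]"
  have degE: "Polynomial.degree E = n"
    by (simp add: E_def degree_pcompose n)
  have rootE: "v y \<le> \<rho>" if "poly E y = 0" for y
    using roots[of "\<beta> + y"] that by (simp add: E_def poly_pcompose)
  obtain A where A: "size A = n" "E = Polynomial.smult (Polynomial.lead_coeff E) (\<Prod>x\<in>#A. [:- x, 1:])"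
    using alg_closed_imp_factorization[of E] degE n by force
  have A_le: "v x \<le> \<rho>" if "x \<in># A" for x
  proof (rule rootE)
    show "poly E x = 0"
      using that by (subst A(2)) (auto simp: poly_prod_mset prod_mset_zero_iff)
  qed
  \<comment> \<open>As n > 0 there is a root, and its absolute value is a lower bound for
    \<rho>.\<close>
  have "0 \<le> \<rho>"
    using A_le A(1) n nonneg by (metis dual_order.trans multiset_nonemptyE not_gr_zero size_empty)
  have coeffE: "v (Polynomial.coeff E i) \<le> v (Polynomial.lead_coeff E) * \<rho> ^ (n - i)" if "i \<le> n" for i
    using coeff_le_of_roots_le[of A \<rho> i] A_le \<open>0 \<le> \<rho>\<close> that A(1)
    by (subst A(2)) (auto simp: mult intro: mult_left_mono)
  define H where "H = hasse (n - q) G"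
  define HE where "HE = hasse (n - q) E"
  have HE: "HE = pcompose (map_poly to_ac H) [:\<beta>, 1:]"
    by (simp add: HE_def E_def H_def hasse_pcompose to_ac.map_hasse)
  \<comment> \<open>The derivative of order n - q puts (n choose (n - q)) in front of the leading
    coefficient; symmetry turns it into the unit (n choose q).\<close>
  have nq: "n choose (n - q) = n choose q"
    using q binomial_symmetric by metis
  have lc: "v (Polynomial.coeff HE q) = v (Polynomial.lead_coeff E)"
    using q nq degE by (simp add: HE_def coeff_hasse mult)
  have degHE: "Polynomial.degree HE = q"
  proof (rule antisym)
    show "Polynomial.degree HE \<le> q"
      using degree_hasse_le[of "n - q" E] q degE by (simp add: HE_def)
    have "E \<noteq> 0" using degE n by auto
    then have "v (Polynomial.coeff HE q) \<noteq> 0"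
      using lc by simp
    then show "q \<le> Polynomial.degree HE"
      by (intro le_degree) auto
  qed
  have degH: "Polynomial.degree H = q"
    using degHE by (simp add: HE degree_pcompose)
  have "HE \<noteq> 0" using degHE q by auto
  obtain y where y: "poly HE y = 0"
    using alg_closed_imp_poly_has_root[of HE] degHE q by auto
  have "v y \<le> \<rho>"
  proof (rule root_le_of_coeff_le[OF \<open>HE \<noteq> 0\<close> _ \<open>0 \<le> \<rho>\<close> y])
    fix i assume "i < Polynomial.degree HE"
    then have i: "i < q" by (simp add: degHE)
    \<comment> \<open>Integers have absolute value at most 1, so differentiation does not enlarge
      coefficients, and the distance q - i to the top degree is unchanged.\<close>
    have "v (Polynomial.coeff HE i) \<le> v (Polynomial.coeff E (i + (n - q)))"
      using mult_right_mono[OF of_nat_le_1 nonneg] by (simp add: HE_def coeff_hasse mult)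
    also have "\<dots> \<le> v (Polynomial.lead_coeff E) * \<rho> ^ (q - i)"
      using coeffE[of "i + (n - q)"] i q by (simp add: Suc_diff_le)
    finally show "v (Polynomial.coeff HE i) \<le> v (Polynomial.lead_coeff HE) * \<rho> ^ (Polynomial.degree HE - i)"
      using lc by (simp add: degHE)
  qed
  moreover have "H \<noteq> 0" using degH q by auto
  moreover have "poly (map_poly to_ac H) (\<beta> + y) = 0"
    using y by (simp add: HE poly_pcompose)
  ultimately show ?thesis
    using degH by (intro exI[of _ "\<beta> + y"] exI[of _ H]) (auto simp: q_def)
qed

section \<open>Simple extensions\<close>

text \<open>The ring K[u]. Every u is algebraic over K, so it is the field K(u).\<close>

definition simple_ext :: "'k::field alg_closure \<Rightarrow> 'k alg_closure set" where
  "simple_ext u = range (\<lambda>f. poly (map_poly to_ac f) u)"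

lemma is_subfield_simple_ext: "is_subfield (simple_ext u)"
proof -
  have in_ext: "poly (map_poly to_ac f) u \<in> simple_ext u" for f
    by (auto simp: simple_ext_def)
  have const: "to_ac c \<in> simple_ext u" for c
    using in_ext[of "[:c:]"] by simp
  have add: "x + y \<in> simple_ext u" and mult: "x * y \<in> simple_ext u"
    if "x \<in> simple_ext u" "y \<in> simple_ext u" for x y
  proof -
    from that obtain f g where "x = poly (map_poly to_ac f) u" "y = poly (map_poly to_ac g) u"
      by (auto simp: simple_ext_def)
    then show "x + y \<in> simple_ext u" "x * y \<in> simple_ext u"
      using in_ext[of "f + g"] in_ext[of "f * g"] by (auto simp: to_ac.map_add to_ac.map_mult)
  qed
  have uminus: "- x \<in> simple_ext u" if "x \<in> simple_ext u" for x
    using mult[OF const[of "-1"] that] by simp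
  have poly: "poly (map_poly to_ac g) y \<in> simple_ext u" if "y \<in> simple_ext u" for g y
    by (induction g) (use const[of 0] in \<open>auto intro!: add mult const that\<close>)
  have inv: "inverse y \<in> simple_ext u" if y: "y \<in> simple_ext u" for y
  proof (cases "y = 0")
    case False
    obtain g where g: "g \<noteq> 0" "poly (map_poly to_ac g) y = 0"
      using alg_closure_algebraic by blast
    \<comment> \<open>After removal of a power of z, possible as y is not 0, the equation for y
      reads y s(y) = -c with c not 0, which gives the inverse.\<close>
    obtain r where r: "g = [:0, 1:] ^ Polynomial.order 0 g * r" "\<not> [:0, 1:] dvd r"
      using order_decomp[OF \<open>g \<noteq> 0\<close>, of 0] by auto
    obtain c s where s: "r = pCons c s" by (cases r) auto
    have "pCons 0 s = [:0, 1:] * s" by simp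
    then have "c \<noteq> 0"
      using r(2) s by (metis dvd_triv_left)
    have pow: "map_poly to_ac ([:0, 1:] ^ k) = [:0, 1:] ^ k" for k :: nat
      by (induction k) (simp_all only: power_0 power_Suc to_ac.map_mult, auto)
    have "poly (map_poly to_ac r) y = 0"
      using g(2) False by (subst (asm) r(1)) (simp add: to_ac.map_mult pow)
    then have "y * poly (map_poly to_ac s) y = - to_ac c"
      by (simp add: s eq_neg_iff_add_eq_0 add.commute)
    then have "inverse y = - (inverse (to_ac c) * poly (map_poly to_ac s) y)"
      using False \<open>c \<noteq> 0\<close> by (simp add: field_simps)
    moreover have "- (to_ac (inverse c) * poly (map_poly to_ac s) y) \<in> simple_ext u"
      by (intro uminus mult const poly y)
    ultimately show ?thesis by simp
  qed (use const[of 0] in auto)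
  show ?thesis
    using const[of 0] const[of 1] by (auto simp: is_subfield_def intro: add mult uminus inv)
qed

lemma ext_degree_le:
  assumes H: "H \<noteq> 0" "poly (map_poly to_ac H) u = 0"
    and \<alpha>: "set_option \<alpha> \<subseteq> simple_ext u"
  shows "ext_degree \<alpha> \<le> Polynomial.degree H"
proof -
  interpret V: vector_space "\<lambda>(c::'a) x. to_ac c * x"
    by standard (auto simp: algebra_simps)
  let ?B = "(\<lambda>i. u ^ i) ` {..<Polynomial.degree H}"
  have "range to_ac \<subseteq> simple_ext u"
  proof
    fix x :: "'a alg_closure" assume "x \<in> range to_ac"
    then obtain c where "x = to_ac c" by auto
    then have "x = poly (map_poly to_ac [:c:]) u" by simp
    then show "x \<in> simple_ext u" unfolding simple_ext_def by (rule range_eqI)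
  qed
  then have "adjoin \<alpha> \<subseteq> simple_ext u"
    unfolding adjoin_def using \<alpha> by (intro hull_minimal is_subfield_simple_ext) auto
  also have "simple_ext u \<subseteq> V.span ?B"
  proof
    fix x assume "x \<in> simple_ext u"
    then obtain f where f: "x = poly (map_poly to_ac f) u"
      by (auto simp: simple_ext_def)
    define r where "r = f mod H"
    have "poly (map_poly to_ac (f div H * H + r)) u =
        poly (map_poly to_ac (f div H * H)) u + poly (map_poly to_ac r) u"
      by (simp only: to_ac.map_add poly_add)
    moreover have "f div H * H + r = f" by (simp add: r_def)
    ultimately have x: "x = poly (map_poly to_ac r) u"
      using H(2) by (simp add: f to_ac.map_mult)
    have "r = 0 \<or> Polynomial.degree r < Polynomial.degree H"
      using H(1) by (simp add: r_def degree_mod_less)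
    then have "to_ac (Polynomial.coeff r i) * u ^ i \<in> V.span ?B" if "i \<le> Polynomial.degree r" for i
    proof (cases "r = 0")
      case False
      with \<open>r = 0 \<or> _\<close> that have "u ^ i \<in> ?B" by auto
      then show ?thesis by (intro V.span_scale V.span_base)
    qed (auto intro: V.span_zero)
    then show "x \<in> V.span ?B"
      unfolding x poly_altdef to_ac.coeff_map to_ac.degree_map
      by (intro V.span_sum) auto
  qed
  finally have "V.dim (adjoin \<alpha>) \<le> card ?B"
    by (intro V.dim_le_card) auto
  also have "\<dots> \<le> Polynomial.degree H"
    using card_image_le[of "{..<Polynomial.degree H}"] by simp
  finally show ?thesis
    by (simp add: ext_degree_def)
qed

section \<open>Multiplicative seminorms and Gauss norms\<close>

locale mult_seminorm_over = nonarch_field w for w :: "'c::field \<Rightarrow> real" +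
  fixes x :: "'c poly \<Rightarrow> real"
  assumes seminorm: "mult_seminorm w x"
begin

lemma sn_nonneg [simp]: "0 \<le> x f"
  and sn_add_le: "x (f + g) \<le> x f + x g"
  and sn_mult: "x (f * g) = x f * x g"
  and sn_const [simp]: "x [:c:] = w c"
  using seminorm by (auto simp: mult_seminorm_def)

lemma sn_0 [simp]: "x 0 = 0"
  using sn_const[of 0] by simp

lemma sn_1 [simp]: "x 1 = 1"
  using sn_const[of 1] by (simp add: one_pCons)

lemma sn_power: "x (f ^ n) = x f ^ n"
  by (induction n) (auto simp: sn_mult)

lemma sn_smult: "x (Polynomial.smult c f) = w c * x f"
  using sn_mult[of "[:c:]" f] by simp

lemma sn_uminus: "x (- f) = x f"
  using sn_smult[of "-1" f] by simp

lemma sn_sum_le: "x (\<Sum>i\<in>A. f i) \<le> (\<Sum>i\<in>A. x (f i))"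
proof (induction A rule: infinite_finite_induct)
  case (insert a A)
  then show ?case using sn_add_le[of "f a" "sum f A"] by simp
qed auto

text \<open>\<open>mult_seminorm\<close> contains only the triangle inequality. In the binomial
  expansion of (f + g)^n the integer coefficients have value at most 1, so x(f + g)^n is at most n +
  1 times the n-th power of the maximum; let n tend to infinity.\<close>

lemma sn_add_le_max: "x (f + g) \<le> max (x f) (x g)"
proof (rule ccontr)
  define b where "b = max (x f) (x g)"
  assume "\<not> x (f + g) \<le> max (x f) (x g)"
  then have less: "b < x (f + g)" by (simp only: b_def not_le)
  have "0 \<le> b" by (simp add: b_def le_max_iff_disj)
  have bound: "x (f + g) ^ n \<le> real (Suc n) * b ^ n" for n
  proof -
    have "x (f + g) ^ n = x (\<Sum>k\<le>n. of_nat (n choose k) * f ^ k * g ^ (n - k))"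
      by (simp add: binomial_ring flip: sn_power)
    also have "\<dots> \<le> (\<Sum>k\<le>n. x (of_nat (n choose k) * f ^ k * g ^ (n - k)))"
      by (rule sn_sum_le)
    also have "\<dots> \<le> (\<Sum>k\<le>n. b ^ n)"
    proof (rule sum_mono)
      fix k assume "k \<in> {..n}"
      have "x (of_nat (n choose k)) \<le> 1"
        by (simp add: of_nat_poly of_nat_le_1)
      then have "x (of_nat (n choose k) * f ^ k * g ^ (n - k)) \<le> 1 * b ^ k * b ^ (n - k)"
        unfolding sn_mult sn_power
        by (intro mult_mono power_mono) (auto simp: b_def \<open>0 \<le> b\<close> le_max_iff_disj)
      then show "x (of_nat (n choose k) * f ^ k * g ^ (n - k)) \<le> b ^ n"
        using \<open>k \<in> {..n}\<close> by (simp flip: power_add)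
    qed
    also have "\<dots> = real (Suc n) * b ^ n" by simp
    finally show ?thesis .
  qed
  \<comment> \<open>For b = 0 the case n = 1 already forces x(f + g) = 0.\<close>
  have "b \<noteq> 0" using bound[of 1] less by auto
  with \<open>0 \<le> b\<close> have "0 < b" by simp
  define t where "t = x (f + g) / b"
  have "1 < t" using less \<open>0 < b\<close> by (simp add: t_def)
  have "1 \<le> real n / t ^ n + inverse t ^ n" for n
    using bound[of n] \<open>0 < b\<close> less
    by (simp add: t_def power_divide field_simps)
  moreover have "(\<lambda>n. real n / t ^ n + inverse t ^ n) \<longlonglongrightarrow> 0 + 0"
    using \<open>1 < t\<close> by (intro tendsto_add lim_n_over_pown LIMSEQ_power_zero) (auto simp: field_simps)
  ultimately have "(1::real) \<le> 0 + 0"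
    by (intro LIMSEQ_le_const) auto
  then show False by simp
qed

text \<open>The condition 1 \<le> \<rho> lets the one factor \<open>\<rho> ^ n\<close> serve for all
  monomials. Small coefficients thus give small values, and the bound depends on the point only
  through \<rho>.\<close>

lemma sn_le_of_coeff_le:
  assumes "x [:0, 1:] \<le> \<rho>" "1 \<le> \<rho>" "0 \<le> \<eta>" "Polynomial.degree f \<le> n"
    and "\<And>i. w (Polynomial.coeff f i) \<le> \<eta>"
  shows "x f \<le> \<eta> * \<rho> ^ n"
  using assms(4,5)
proof (induction f arbitrary: n)
  case (pCons a f)
  have "w a \<le> \<eta>" using pCons.prems(2)[of 0] by simp
  moreover have "\<eta> \<le> \<eta> * \<rho> ^ n"
    using assms by (simp add: mult_le_cancel_left1)
  moreover have "x ([:0, 1:] * f) \<le> \<eta> * \<rho> ^ n"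
  proof (cases "f = 0")
    case False
    then obtain m where m: "n = Suc m" "Polynomial.degree f \<le> m"
      using pCons.prems(1) by (cases n) auto
    have "w (Polynomial.coeff f i) \<le> \<eta>" for i
      using pCons.prems(2)[of "Suc i"] by simp
    then have "x f \<le> \<eta> * \<rho> ^ m"
      using pCons.IH m by blast
    then have "x [:0, 1:] * x f \<le> \<rho> * (\<eta> * \<rho> ^ m)"
      using assms by (intro mult_mono) auto
    then have "x ([:0, 1:] * f) \<le> \<rho> * (\<eta> * \<rho> ^ m)"
      by (simp only: sn_mult)
    then show ?thesis by (simp only: m power_Suc mult_ac)
  qed (use assms in auto)
  moreover have "pCons a f = [:a:] + [:0, 1:] * f" by simp
  ultimately show ?case
    using sn_add_le_max[of "[:a:]" "[:0, 1:] * f"] by (auto simp del: mult_pCons_left)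
qed (use assms in auto)

lemma sn_prod_linear: "x (\<Prod>c\<in>#A. [:- c, 1:]) = (\<Prod>c\<in>#A. x [:- c, 1:])"
  by (induction A) (auto simp: sn_mult simp del: mult_pCons_left)

end

section \<open>Gauss norms\<close>

context nonarch_field
begin

text \<open>The maximum of |a_i| t^i over the coefficients a_i, in Horner form, which makes
  continuity in t a plain induction. At t = 0 it is |a_0|.\<close>

definition gauss0 :: "real \<Rightarrow> 'a poly \<Rightarrow> real" where
  "gauss0 t f = fold_coeffs (\<lambda>a s. max (w a) (t * s)) f 0"

lemma gauss0_0 [simp]: "gauss0 t 0 = 0"
  by (simp add: gauss0_def)

lemma gauss0_pCons [simp]: "gauss0 t (pCons a f) = max (w a) (t * gauss0 t f)"
  by (cases "a = 0 \<and> f = 0") (auto simp: gauss0_def)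

lemma continuous_on_gauss0: "continuous_on S (\<lambda>t. gauss0 t f)"
  by (induction f) (auto intro!: continuous_intros)

lemma gauss0_nonneg [simp]: "0 \<le> t \<Longrightarrow> 0 \<le> gauss0 t f"
  by (cases f) (auto simp: le_max_iff_disj)

lemma coeff_le_gauss0: "0 \<le> t \<Longrightarrow> w (Polynomial.coeff f i) * t ^ i \<le> gauss0 t f"
proof (induction f arbitrary: i)
  case (pCons a f)
  show ?case
  proof (cases i)
    case (Suc j)
    have "t * (w (Polynomial.coeff f j) * t ^ j) \<le> t * gauss0 t f"
      using pCons by (intro mult_left_mono) auto
    then show ?thesis by (simp add: Suc mult_ac le_max_iff_disj)
  qed auto
qed auto

lemma gauss0_attained: "\<exists>i. gauss0 t f = w (Polynomial.coeff f i) * t ^ i"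
proof (induction f)
  case (pCons a f)
  then obtain i where i: "gauss0 t f = w (Polynomial.coeff f i) * t ^ i" by blast
  show ?case
  proof (cases "w a \<le> t * gauss0 t f")
    case True
    then show ?thesis
      using i by (intro exI[of _ "Suc i"]) (simp add: max_def mult_ac)
  next
    case False
    then show ?thesis by (intro exI[of _ 0]) (simp add: max_def)
  qed
qed auto

lemma gauss0_add_le:
  assumes "0 \<le> t"
  shows "gauss0 t (f + g) \<le> max (gauss0 t f) (gauss0 t g)"
proof -
  obtain i where "gauss0 t (f + g) = w (Polynomial.coeff (f + g) i) * t ^ i"
    using gauss0_attained by blast
  also have "\<dots> \<le> max (w (Polynomial.coeff f i)) (w (Polynomial.coeff g i)) * t ^ i"
    using assms add_le by (intro mult_right_mono) auto
  also have "\<dots> \<le> max (gauss0 t f) (gauss0 t g)"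
    using coeff_le_gauss0[OF assms, of f i] coeff_le_gauss0[OF assms, of g i]
    by (auto simp: max_def)
  finally show ?thesis .
qed

lemma gauss0_mult_le:
  assumes "0 \<le> t"
  shows "gauss0 t (f * g) \<le> gauss0 t f * gauss0 t g"
proof -
  obtain k where k: "gauss0 t (f * g) = w (Polynomial.coeff (f * g) k) * t ^ k"
    using gauss0_attained by blast
  show ?thesis
  proof (cases "t ^ k = 0")
    case True
    then have "gauss0 t (f * g) = 0" by (simp only: k mult_zero_right)
    then show ?thesis using assms by simp
  next
    case False
    then have tk: "0 < t ^ k"
      using assms zero_le_power[of t k] by linarith
    have "w (Polynomial.coeff f i * Polynomial.coeff g (k - i)) \<le> gauss0 t f * gauss0 t g / t ^ k"
      if "i \<in> {..k}" for i
    proof -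
      have "(w (Polynomial.coeff f i) * t ^ i) * (w (Polynomial.coeff g (k - i)) * t ^ (k - i))
          \<le> gauss0 t f * gauss0 t g"
        using assms by (intro mult_mono coeff_le_gauss0) auto
      also have "(w (Polynomial.coeff f i) * t ^ i) * (w (Polynomial.coeff g (k - i)) * t ^ (k - i))
          = w (Polynomial.coeff f i * Polynomial.coeff g (k - i)) * (t ^ i * t ^ (k - i))"
        by (simp add: mult mult_ac)
      also have "t ^ i * t ^ (k - i) = t ^ k"
        using that by (simp flip: power_add)
      finally show ?thesis using tk by (simp add: field_simps)
    qed
    then have "w (Polynomial.coeff (f * g) k) \<le> gauss0 t f * gauss0 t g / t ^ k"
      unfolding coeff_mult using assms tk by (intro sum_le) auto
    then show ?thesis using k tk by (simp add: field_simps)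
  qed
qed

text \<open>Gauss's lemma: at the sum of the first indices at which the two maxima are attained, a
  single summand of the convolution dominates.\<close>
lemma gauss0_mult_ge:
  assumes t: "0 \<le> t"
  shows "gauss0 t f * gauss0 t g \<le> gauss0 t (f * g)"
proof (cases "gauss0 t f = 0 \<or> gauss0 t g = 0")
  case True
  then show ?thesis using t by auto
next
  case False
  then have pos: "0 < gauss0 t f" "0 < gauss0 t g"
    using gauss0_nonneg[OF t] by (metis less_eq_real_def)+
  have first: "\<exists>i. w (Polynomial.coeff q i) * t ^ i = gauss0 t q \<and>
      (\<forall>j<i. w (Polynomial.coeff q j) * t ^ j < gauss0 t q)" for q
  proof -
    define i where "i = (LEAST i. w (Polynomial.coeff q i) * t ^ i = gauss0 t q)"
    have "w (Polynomial.coeff q i) * t ^ i = gauss0 t q"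
      unfolding i_def by (rule LeastI_ex) (metis gauss0_attained)
    moreover have "w (Polynomial.coeff q j) * t ^ j < gauss0 t q" if "j < i" for j
      using not_less_Least[of j "\<lambda>i. w (Polynomial.coeff q i) * t ^ i = gauss0 t q"] that
        coeff_le_gauss0[OF t, of q j] by (auto simp: i_def less_eq_real_def)
    ultimately show ?thesis by blast
  qed
  obtain i where i: "w (Polynomial.coeff f i) * t ^ i = gauss0 t f"
    "\<And>l. l < i \<Longrightarrow> w (Polynomial.coeff f l) * t ^ l < gauss0 t f"
    using first[of f] by blast
  obtain j where j: "w (Polynomial.coeff g j) * t ^ j = gauss0 t g"
    "\<And>l. l < j \<Longrightarrow> w (Polynomial.coeff g l) * t ^ l < gauss0 t g"
    using first[of g] by blast
  define k where "k = i + j"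
  define c where "c l = Polynomial.coeff f l * Polynomial.coeff g (k - l)" for l
  define N where "N = gauss0 t f * gauss0 t g"
  \<comment> \<open>The two maxima are positive, so these powers do not vanish, even for t = 0,
    where i = j = 0.\<close>
  have "t ^ i \<noteq> 0" "t ^ j \<noteq> 0"
    using i(1) j(1) pos by (metis less_irrefl mult_zero_right)+
  then have tk: "0 < t ^ k"
    using zero_le_power[OF t, of i] zero_le_power[OF t, of j] unfolding k_def power_add
    by (intro mult_pos_pos) linarith+
  have split: "w (c l) * t ^ k =
      (w (Polynomial.coeff f l) * t ^ l) * (w (Polynomial.coeff g (k - l)) * t ^ (k - l))"
    if "l \<le> k" for l
  proof -
    have "t ^ k = t ^ l * t ^ (k - l)"
      using that by (simp flip: power_add)
    then show ?thesis by (simp add: c_def mult mult_ac)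
  qed
  have main: "w (c i) * t ^ k = N"
    using split[of i] i j by (simp add: k_def N_def)
  have "w (c l) < N / t ^ k" if "l \<in> {..k} - {i}" for l
  proof -
    have "l \<le> k" "l \<noteq> i" using that by auto
    then have "l < i \<or> k - l < j" unfolding k_def by linarith
    with \<open>l \<le> k\<close> consider "l < i" | "k - l < j" "l \<le> k" by blast
    then have "w (c l) * t ^ k < N"
    proof cases
      case 1
      then have "w (c l) * t ^ k \<le> (w (Polynomial.coeff f l) * t ^ l) * gauss0 t g"
        using t by (subst split) (auto simp: k_def intro!: mult_left_mono coeff_le_gauss0)
      also have "\<dots> < N"
        unfolding N_def using i(2)[OF 1] pos by (intro mult_strict_right_mono)
      finally show ?thesis .
    next
      case 2
      then have "w (c l) * t ^ k \<le> gauss0 t f * (w (Polynomial.coeff g (k - l)) * t ^ (k - l))"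
        using t by (subst split) (auto intro!: mult_right_mono coeff_le_gauss0)
      also have "\<dots> < N"
        unfolding N_def using j(2)[OF 2(1)] pos by (intro mult_strict_left_mono)
      finally show ?thesis .
    qed
    then show ?thesis using tk by (simp add: field_simps)
  qed
  then have "w (\<Sum>l\<in>{..k} - {i}. c l) < N / t ^ k"
    using pos tk by (intro sum_less) (auto simp: N_def)
  also have "N / t ^ k = w (c i)"
    using main tk by (metis less_irrefl nonzero_mult_div_cancel_right)
  finally have "w ((\<Sum>l\<in>{..k} - {i}. c l) + c i) = w (c i)"
    by (rule add_eq_if_less)
  moreover have "Polynomial.coeff (f * g) k = (\<Sum>l\<in>{..k} - {i}. c l) + c i"
    by (simp add: coeff_mult c_def k_def sum.remove[of "{..i + j}" i])
  ultimately show ?thesis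
    using main coeff_le_gauss0[OF t, of "f * g" k] by (simp add: N_def)
qed

lemma gauss0_mult: "0 \<le> t \<Longrightarrow> gauss0 t (f * g) = gauss0 t f * gauss0 t g"
  by (simp add: antisym gauss0_mult_le gauss0_mult_ge)

text \<open>The disk of radius t around z as a seminorm, read off the expansion at z. It makes sense
  for every real t \<ge> 0, with the classical point z at t = 0, so t can run through an interval
  and trace a path.\<close>

definition gauss :: "'a \<Rightarrow> real \<Rightarrow> 'a poly \<Rightarrow> real" where
  "gauss z t f = gauss0 t (pcompose f [:z, 1:])"

lemma mult_seminorm_gauss:
  assumes "0 \<le> t"
  shows "mult_seminorm w (gauss z t)"
  unfolding mult_seminorm_def
proof (intro conjI allI)
  fix f g
  show "gauss z t (f + g) \<le> gauss z t f + gauss z t g"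
    using gauss0_add_le[OF assms] gauss0_nonneg[OF assms]
    by (simp add: gauss_def pcompose_add) (smt (verit))
qed (auto simp: assms gauss_def pcompose_mult gauss0_mult pcompose_const max_def)

lemma gauss_linear: "0 \<le> t \<Longrightarrow> gauss z t [:- c, 1:] = max (w (z - c)) t"
  by (simp add: gauss_def pcompose_pCons max_def)

lemma gauss_0: "gauss z 0 f = w (poly f z)"
proof -
  have "gauss0 0 f = w (Polynomial.coeff f 0)" for f
    by (cases f) (auto simp: max_def)
  then show ?thesis
    by (simp add: gauss_def poly_pcompose flip: poly_0_coeff_0)
qed

lemma type1_Some: "type1 w (Some z) = Some (gauss z 0)"
  by (auto simp: type1_def gauss_0)

lemma type1_None [simp]: "type1 w None = None"
  by (simp add: type1_def)

lemma type1_eq_iff: "type1 w a = type1 w a' \<longleftrightarrow> a = a'"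
proof (cases a; cases a')
  fix z z' assume "a = Some z" "a' = Some z'"
  moreover have "z = z'" if "gauss z 0 = gauss z' 0"
    using arg_cong[OF that, of "\<lambda>x. x [:- z, 1:]"] by (simp add: gauss_linear max_def split: if_splits)
  ultimately show ?thesis
    by (auto simp: type1_Some)
qed (auto simp: type1_def)

text \<open>The residue field of an algebraically closed field is infinite, so some class avoids
  finitely many. The witness is a root u of f - 1, where f vanishes on S: the product of all |u -
  \<gamma>| is 1, which rules out |u| > 1, and then no factor can be below 1.\<close>

lemma exists_unit_away_from:
  assumes "finite S" "\<And>\<gamma>. \<gamma> \<in> S \<Longrightarrow> w \<gamma> \<le> 1"
    and alg_closed: "\<And>f :: 'a poly. Polynomial.degree f > 0 \<Longrightarrow> \<exists>y. poly f y = 0"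
  shows "\<exists>u. w u \<le> 1 \<and> (\<forall>\<gamma>\<in>S. w (u - \<gamma>) = 1)"
proof -
  \<comment> \<open>The added 0 keeps f nonconstant when S is empty.\<close>
  define f where "f = (\<Prod>\<gamma>\<in>insert 0 S. [:- \<gamma>, 1:])"
  have deg: "Polynomial.degree f = card (insert 0 S)"
    unfolding f_def by (subst degree_prod_eq_sum_degree) auto
  have "Polynomial.degree (f - 1) = card (insert 0 S)"
    using deg assms(1) by (subst diff_conv_add_uminus, subst degree_add_eq_left) (auto simp: card_gt_0_iff)
  moreover have "card (insert 0 S) > 0"
    using assms(1) by (simp add: card_gt_0_iff)
  ultimately obtain u where "poly (f - 1) u = 0"
    using alg_closed[of "f - 1"] by auto
  then have "(\<Prod>\<gamma>\<in>insert 0 S. u - \<gamma>) = 1"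
    by (simp add: f_def poly_prod)
  moreover have "w (\<Prod>\<gamma>\<in>A. u - \<gamma>) = (\<Prod>\<gamma>\<in>A. w (u - \<gamma>))" for A
    by (induction A rule: infinite_finite_induct) (auto simp: mult)
  ultimately have prod: "(\<Prod>\<gamma>\<in>insert 0 S. w (u - \<gamma>)) = 1"
    by (metis one)
  have "w u \<le> 1"
  proof (rule ccontr)
    assume "\<not> w u \<le> 1"
    then have "w (u - \<gamma>) > 1" if "\<gamma> \<in> insert 0 S" for \<gamma>
    proof -
      have "w \<gamma> \<le> 1" using that assms(2) by auto
      with \<open>\<not> w u \<le> 1\<close> show ?thesis
        using add_eq_if_less[of "- \<gamma>" u] by simp
    qed
    then have "(\<Prod>\<gamma>\<in>insert 0 S. w (u - \<gamma>)) > 1"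
      using assms(1) by (intro less_1_prod) auto
    with prod show False by simp
  qed
  have le: "w (u - \<gamma>) \<le> 1" if "\<gamma> \<in> insert 0 S" for \<gamma>
    using that assms(2) \<open>w u \<le> 1\<close> diff_le[of u \<gamma>] by (fastforce simp: max_def split: if_splits)
  have "w (u - \<gamma>) = 1" if "\<gamma> \<in> S" for \<gamma>
  proof (rule antisym)
    have "(\<Prod>\<gamma>\<in>insert 0 S - {\<gamma>}. w (u - \<gamma>)) \<le> 1"
      using le by (intro prod_le_1) auto
    then have "w (u - \<gamma>) * (\<Prod>\<gamma>\<in>insert 0 S - {\<gamma>}. w (u - \<gamma>)) \<le> w (u - \<gamma>)"
      by (simp add: mult_left_le)
    then show "1 \<le> w (u - \<gamma>)"
      using prod that assms(1) prod.remove[of "insert 0 S" \<gamma> "\<lambda>\<gamma>. w (u - \<gamma>)"] by simp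
  qed (use le that in auto)
  with \<open>w u \<le> 1\<close> show ?thesis by blast
qed

end

section \<open>Approximation from a dense algebraically closed subfield\<close>

locale dense_alg_closed_subfield = nonarch_field w + field_embedding \<iota>
  for w :: "'c::field \<Rightarrow> real" and \<iota> :: "'l::alg_closed_field \<Rightarrow> 'c" +
  assumes dense: "0 < \<epsilon> \<Longrightarrow> \<exists>y. w (z - \<iota> y) < \<epsilon>"
begin

lemma nonarch_absv_restrict: "nonarch_absv (\<lambda>y. w (\<iota> y))"
  using add_le by (auto simp: nonarch_absv_def h_mult h_add mult)

lemma exists_poly_approx:
  assumes "0 < \<epsilon>"
  shows "\<exists>g. Polynomial.degree g \<le> Polynomial.degree f \<and>
    (\<forall>i. w (Polynomial.coeff (f - map_poly \<iota> g) i) \<le> \<epsilon>)"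
proof -
  obtain y where y: "\<And>z. w (z - \<iota> (y z)) < \<epsilon>"
    using dense[OF assms] by metis
  \<comment> \<open>Cut off at the degree of f, since the approximation chosen for the coefficient 0
    need not be 0.\<close>
  define g where "g = (\<Sum>i\<le>Polynomial.degree f. Polynomial.monom (y (Polynomial.coeff f i)) i)"
  have coeff: "Polynomial.coeff g i = (if i \<le> Polynomial.degree f then y (Polynomial.coeff f i) else 0)" for i
    by (auto simp: g_def coeff_sum_monom) (simp add: coeff_sum)
  have "w (Polynomial.coeff (f - map_poly \<iota> g) i) \<le> \<epsilon>" for i
    using y[of "Polynomial.coeff f i"] assms by (auto simp: coeff coeff_eq_0)
  moreover have "Polynomial.degree g \<le> Polynomial.degree f"
    by (intro degree_le) (auto simp: coeff)
  ultimately show ?thesis by blast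
qed

text \<open>Linear factors suffice, because every polynomial can be approximated by products of them.\<close>
lemma seminorm_eq_zeta:
  assumes x: "mult_seminorm w x"
    and lin: "\<And>c. x [:- c, 1:] = max r (w (c - b))"
    and r: "r \<in> w ` (UNIV - {0})"
  shows "Some x = zeta w b r"
proof -
  interpret x: mult_seminorm_over w x
    by unfold_locales (rule x)
  interpret L: nonarch_field "\<lambda>y. w (\<iota> y)"
    by standard (rule nonarch_absv_restrict)
  have "0 < r" using r by auto
  define D where "D = {z. w (z - b) \<le> r}"
  have "b \<in> D" using \<open>0 < r\<close> by (simp add: D_def)
  define \<rho> where "\<rho> = max 1 (max r (w b))"
  have rho: "1 \<le> \<rho>" "x [:0, 1:] \<le> \<rho>"
    using lin[of 0] by (auto simp: \<rho>_def)
  \<comment> \<open>Centre and radius are both realised in the dense subfield: an element closer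
    than r to t has absolute value exactly r.\<close>
  obtain b' where b': "w (b - \<iota> b') < r" using dense[OF \<open>0 < r\<close>] by blast
  obtain \<tau> where \<tau>: "w (\<iota> \<tau>) = r"
  proof -
    obtain t where t: "r = w t" using r by auto
    obtain \<tau> where "w (t - \<iota> \<tau>) < r" using dense[OF \<open>0 < r\<close>] by blast
    then have "w ((\<iota> \<tau> - t) + t) = w t"
      using t by (intro add_eq_if_less) (simp add: minus_commute)
    then show ?thesis using that t by simp
  qed
  then have "\<tau> \<noteq> 0" using \<open>0 < r\<close> by auto
  have dist_le: "w (z - c) \<le> max r (w (c - b))" if "z \<in> D" for z c
    using that add_le[of "z - b" "b - c"] minus_commute[of b c] by (auto simp: D_def)
  have map_prod: "map_poly \<iota> (\<Prod>x\<in>#A. [:- x, 1:]) = (\<Prod>x\<in>#image_mset \<iota> A. [:- x, 1:])" for A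
    by (induction A) (simp_all add: map_mult h_uminus del: mult_pCons_left)
  have split: "x (map_poly \<iota> g) \<ge> w (poly (map_poly \<iota> g) z)" if "z \<in> D" for g z
  proof (cases "g = 0")
    case False
    obtain A where A: "g = Polynomial.smult (Polynomial.lead_coeff g) (\<Prod>x\<in>#A. [:- x, 1:])"
      using alg_closed_imp_factorization[OF False] by blast
    define B where "B = image_mset \<iota> A"
    have "w (\<Prod>c\<in>#B. z - c) \<le> (\<Prod>c\<in>#B. max r (w (c - b)))"
      using dist_le[OF that] \<open>0 < r\<close>
    proof (induction B)
      case (add c B)
      then show ?case
        by (auto simp: mult le_max_iff_disj intro!: mult_mono)
    qed auto
    then show ?thesis
      by (subst (1 2) A) (simp add: map_smult map_prod x.sn_smult x.sn_prod_linear lin mult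
        poly_prod_mset mult_left_mono flip: B_def)
  qed auto
  \<comment> \<open>Roots outside the disk are equally far from all its points. Those inside are
    rescaled to the unit disk, where a point u avoiding all their residue classes yields a z at
    distance exactly r from each.\<close>
  have attained: "\<exists>z\<in>D. w (poly (map_poly \<iota> g) z) = x (map_poly \<iota> g)" for g
  proof (cases "g = 0")
    case False
    obtain A where A: "g = Polynomial.smult (Polynomial.lead_coeff g) (\<Prod>x\<in>#A. [:- x, 1:])"
      using alg_closed_imp_factorization[OF False] by blast
    define S where "S = (\<lambda>c. (c - b') / \<tau>) ` {c \<in> set_mset A. w (\<iota> c - b) \<le> r}"
    have "w (\<iota> \<gamma>) \<le> 1" if "\<gamma> \<in> S" for \<gamma>
    proof -
      from that obtain c where c: "\<gamma> = (c - b') / \<tau>" "w (\<iota> c - b) \<le> r"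
        by (auto simp: S_def)
      have "w (\<iota> (c - b')) \<le> r"
        using c(2) b' add_le[of "\<iota> c - b" "b - \<iota> b'"] by (simp add: h_diff)
      then show ?thesis
        using \<tau> \<open>0 < r\<close> by (simp add: c(1) h_divide divide)
    qed
    moreover have "finite S" by (simp add: S_def)
    ultimately obtain u where u: "w (\<iota> u) \<le> 1" "\<And>\<gamma>. \<gamma> \<in> S \<Longrightarrow> w (\<iota> (u - \<gamma>)) = 1"
      using L.exists_unit_away_from[of S] alg_closed_imp_poly_has_root by blast
    define z where "z = \<iota> (b' + \<tau> * u)"
    have "w (\<iota> b' - b) \<le> r" using b' by (simp add: minus_commute)
    moreover have "w (\<iota> (\<tau> * u)) \<le> r"
      using u(1) \<tau> \<open>0 < r\<close> by (simp add: h_mult mult mult_left_le)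
    ultimately have "z \<in> D"
      using add_le[of "\<iota> b' - b" "\<iota> (\<tau> * u)"] by (simp add: D_def z_def h_add algebra_simps)
    have "w (z - \<iota> c) = max r (w (\<iota> c - b))" if "c \<in># A" for c
    proof (cases "w (\<iota> c - b) \<le> r")
      case True
      then have "(c - b') / \<tau> \<in> S" using that by (auto simp: S_def)
      then have "w (\<iota> (\<tau> * (u - (c - b') / \<tau>))) = r"
        using u(2) \<tau> by (simp add: h_mult mult)
      also have "\<tau> * (u - (c - b') / \<tau>) = b' + \<tau> * u - c"
        using \<open>\<tau> \<noteq> 0\<close> by (simp add: field_simps)
      finally show ?thesis using True by (simp add: z_def h_diff)
    next
      case False
      then have "w ((z - b) + (b - \<iota> c)) = w (b - \<iota> c)"
        using \<open>z \<in> D\<close> by (intro add_eq_if_less) (simp add: D_def minus_commute)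
      then show ?thesis using False by (simp add: minus_commute)
    qed
    moreover define B where "B = image_mset \<iota> A"
    ultimately have "\<forall>c\<in>#B. w (z - c) = max r (w (c - b))" by auto
    then have "w (\<Prod>c\<in>#B. z - c) = (\<Prod>c\<in>#B. max r (w (c - b)))"
      by (induction B) (auto simp: mult)
    then have "w (poly (map_poly \<iota> g) z) = x (map_poly \<iota> g)"
      by (subst (1 2) A) (simp add: map_smult map_prod x.sn_smult x.sn_prod_linear lin mult
        poly_prod_mset flip: B_def)
    with \<open>z \<in> D\<close> show ?thesis by blast
  qed (use \<open>b \<in> D\<close> in auto)
  define n where "n f = \<rho> ^ Polynomial.degree f" for f :: "'c poly"
  have n: "0 < n f" for f
    using rho by (simp add: n_def)
  \<comment> \<open>One approximant is good at x and at all points of D simultaneously, since the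
    same \<rho> bounds the coordinate at each of them.\<close>
  have approx: "\<exists>g. x (f - map_poly \<iota> g) < \<delta> \<and> (\<forall>z\<in>D. w (poly (f - map_poly \<iota> g) z) < \<delta>)"
    if "0 < \<delta>" for f \<delta>
  proof -
    define \<eta> where "\<eta> = \<delta> / (2 * n f)"
    have \<eta>: "0 < \<eta>" "\<eta> * \<rho> ^ Polynomial.degree f < \<delta>"
      using that n[of f] by (auto simp: \<eta>_def n_def field_simps)
    obtain g where g: "Polynomial.degree g \<le> Polynomial.degree f"
      "\<And>i. w (Polynomial.coeff (f - map_poly \<iota> g) i) \<le> \<eta>"
      using exists_poly_approx[OF \<eta>(1)] by blast
    have deg: "Polynomial.degree (f - map_poly \<iota> g) \<le> Polynomial.degree f"
      using g(1) by (intro degree_diff_le) auto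
    have "w (poly (f - map_poly \<iota> g) z) < \<delta>" if "z \<in> D" for z
    proof -
      interpret z: mult_seminorm_over w "gauss z 0"
        by unfold_locales (simp add: mult_seminorm_gauss)
      have "w z \<le> \<rho>"
        using that add_le[of "z - b" b] by (auto simp: D_def \<rho>_def)
      then have "gauss z 0 (f - map_poly \<iota> g) \<le> \<eta> * \<rho> ^ Polynomial.degree f"
        using \<eta> rho g deg by (intro z.sn_le_of_coeff_le) (auto simp: gauss_0)
      with \<eta>(2) show ?thesis by (simp add: gauss_0)
    qed
    moreover have "x (f - map_poly \<iota> g) \<le> \<eta> * \<rho> ^ Polynomial.degree f"
      using \<eta> rho g deg by (intro x.sn_le_of_coeff_le) auto
    ultimately show ?thesis using \<eta>(2) by (intro exI[of _ g]) auto
  qed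
  \<comment> \<open>If |f(z)| exceeded x f, an approximant with error below |f(z)| would inherit the
    strict inequality, against \<open>split\<close>.\<close>
  have le: "w (poly f z) \<le> x f" if zD: "z \<in> D" for f z
  proof (rule ccontr)
    assume less: "\<not> w (poly f z) \<le> x f"
    then have "0 < w (poly f z)"
      using x.sn_nonneg[of f] by linarith
    then obtain g where g: "x (f - map_poly \<iota> g) < w (poly f z)"
      "w (poly (f - map_poly \<iota> g) z) < w (poly f z)"
      using approx[OF \<open>0 < w (poly f z)\<close>, of f] zD by blast
    have "x (map_poly \<iota> g) < w (poly f z)"
      using x.sn_add_le_max[of f "- (f - map_poly \<iota> g)"] g(1) less
      by (auto simp only: x.sn_uminus) (auto simp: max_def split: if_splits)
    then have "w (poly (map_poly \<iota> g) z) < w (poly f z)"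
      using split[OF zD, of g] by linarith
    then show False
      using add_le[of "poly (map_poly \<iota> g) z" "poly (f - map_poly \<iota> g) z"] g(2) by auto
  qed
  \<comment> \<open>With an error below x f, a point attaining the value of the approximant attains
    that of f. If x f = 0, the bound \<open>le\<close> settles the matter at b.\<close>
  have ex: "\<exists>z\<in>D. w (poly f z) = x f" for f
  proof (cases "x f = 0")
    case True
    then have "w (poly f b) = x f"
      using le[of b f] \<open>0 < r\<close> by (simp add: D_def)
    then show ?thesis
      using \<open>b \<in> D\<close> by blast
  next
    case False
    then have "0 < x f" using x.sn_nonneg[of f] by linarith
    then obtain g where g: "x (f - map_poly \<iota> g) < x f"
      "\<And>z. z \<in> D \<Longrightarrow> w (poly (f - map_poly \<iota> g) z) < x f"
      using approx[OF \<open>0 < x f\<close>, of f] by blast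
    obtain z where z: "z \<in> D" "w (poly (map_poly \<iota> g) z) = x (map_poly \<iota> g)"
      using attained by blast
    have "x f \<le> x (map_poly \<iota> g)"
      using x.sn_add_le_max[of "map_poly \<iota> g" "f - map_poly \<iota> g"] g(1) by auto
    also have "\<dots> \<le> max (w (poly f z)) (w (poly (f - map_poly \<iota> g) z))"
      using z(2) diff_le[of "poly f z" "poly (f - map_poly \<iota> g) z"] by simp
    finally have "x f \<le> w (poly f z)"
      using g(2)[OF z(1)] by auto
    with le[OF z(1), of f] z(1) show ?thesis by (intro bexI[of _ z]) auto
  qed
  have "x f = (SUP z\<in>D. w (poly f z))" for f
  proof -
    obtain z where "z \<in> D" "w (poly f z) = x f" using ex by blast
    then have "x f \<in> (\<lambda>z. w (poly f z)) ` D" by (metis image_eqI)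
    then show ?thesis
      using le by (intro cSup_eq_maximum[symmetric]) auto
  qed
  then show ?thesis
    by (auto simp: zeta_def D_def)
qed

text \<open>The Gauss norm has the values on linear polynomials that characterise the supremum over
  the disk.\<close>

lemma zeta_eq_gauss:
  assumes "r \<in> w ` (UNIV - {0})"
  shows "zeta w b r = Some (gauss b r)"
proof (rule seminorm_eq_zeta[symmetric])
  have "0 \<le> r" using assms by auto
  then show "mult_seminorm w (gauss b r)" "gauss b r [:- c, 1:] = max r (w (c - b))" for c
    using minus_commute[of b c] by (simp_all add: mult_seminorm_gauss gauss_linear max.commute)
qed (rule assms)

end

section \<open>Components of the Berkovich line minus a type II point\<close>

context nonarch_field
begin

section \<open>Compact disks and connected paths\<close>

abbreviation berk_points :: "('a poly \<Rightarrow> real) set" where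
  "berk_points \<equiv> {x. mult_seminorm w x}"

lemma berk_A1_eq: "berk_A1 w = top_of_set berk_points"
  by (simp add: berk_A1_def euclidean_product_topology)

lemma continuous_on_eval [continuous_intros]: "continuous_on S (\<lambda>x :: 'a poly \<Rightarrow> real. x f)"
  by (rule continuous_on_product_coordinates[THEN continuous_on_subset]) auto

lemma closed_berk_points: "closed berk_points"
  unfolding mult_seminorm_def
  by (intro closed_Collect_conj closed_Collect_all closed_Collect_le closed_Collect_eq continuous_intros)

lemma closed_berk_disk: "closed {x \<in> berk_points. x [:- c, 1:] \<le> r}"
proof -
  have "closed (berk_points \<inter> {x. x [:- c, 1:] \<le> r})"
    by (intro closed_Int closed_berk_points closed_Collect_le continuous_intros)
  then show ?thesis by (simp add: Collect_conj_eq)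
qed

text \<open>Tychonoff: a bound for the coordinate bounds every polynomial, so the disk is a closed
  part of a product of compact intervals.\<close>

lemma compact_berk_disk: "compact {x \<in> berk_points. x [:- c, 1:] \<le> r}"
proof -
  define \<rho> where "\<rho> = max r (w c)"
  define B where "B f = (\<Sum>i\<le>Polynomial.degree f. w (Polynomial.coeff f i) * \<rho> ^ i)" for f
  have "x f \<in> {0..B f}" if x: "mult_seminorm w x" "x [:- c, 1:] \<le> r" for x f
  proof -
    interpret x: mult_seminorm_over w x by unfold_locales (rule x)
    have "x [:0, 1:] \<le> \<rho>"
      using x.sn_add_le_max[of "[:- c, 1:]" "[:c:]"] x(2) by (auto simp: \<rho>_def)
    then have "x (Polynomial.monom (Polynomial.coeff f i) i) \<le> w (Polynomial.coeff f i) * \<rho> ^ i" for i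
      by (auto simp: monom_altdef x.sn_smult x.sn_power intro!: mult_left_mono power_mono)
    then have "x (\<Sum>i\<le>Polynomial.degree f. Polynomial.monom (Polynomial.coeff f i) i) \<le> B f"
      unfolding B_def by (intro order_trans[OF x.sn_sum_le] sum_mono)
    then show ?thesis by (simp add: poly_as_sum_of_monoms)
  qed
  then have subset: "{x \<in> berk_points. x [:- c, 1:] \<le> r} \<subseteq> PiE UNIV (\<lambda>f. {0..B f})"
    by auto
  have "compactin (product_topology (\<lambda>_. euclideanreal) UNIV) (PiE UNIV (\<lambda>f :: 'a poly. {0..B f}))"
    by (subst compactin_PiE) auto
  then have "compact (PiE UNIV (\<lambda>f :: 'a poly. {0..B f}))"
    by (simp add: euclidean_product_topology)
  then have "compact (PiE UNIV (\<lambda>f. {0..B f}) \<inter> {x \<in> berk_points. x [:- c, 1:] \<le> r})"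
    using closed_berk_disk by (rule compact_Int_closed)
  then show ?thesis
    by (simp only: inf_absorb2[OF subset])
qed

lemma connectedin_gauss_path:
  assumes "connected T" "T \<subseteq> {0..}"
  shows "connectedin (berk_P1 w) ((\<lambda>t. Some (gauss z t)) ` T)"
proof -
  have "continuous_on T (gauss z)"
    unfolding gauss_def by (intro continuous_on_coordinatewise_then_product continuous_on_gauss0)
  then have "continuous_map (top_of_set T) (berk_A1 w) (gauss z)"
    using assms(2) by (auto simp: berk_A1_eq continuous_map_in_subtopology mult_seminorm_gauss)
  then have "continuous_map (top_of_set T) (berk_P1 w) (Some \<circ> gauss z)"
    unfolding berk_P1_def by (rule continuous_map_compose[OF _ continuous_map_Some])
  then show ?thesis
    using connectedin_continuous_map_image[of "top_of_set T" "berk_P1 w" "Some \<circ> gauss z" T] assms(1)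
    by (simp add: comp_def connectedin_subtopology)
qed

text \<open>On a compact set the evaluation at \<open>[:- z, 1:]\<close> is bounded, whereas at
  \<open>gauss z t\<close> it equals t. Hence the path leaves every compact set and infinity lies in
  its closure.\<close>

lemma connectedin_gauss_ray: "connectedin (berk_P1 w) (insert None ((\<lambda>t. Some (gauss z t)) ` {0..}))"
proof (rule connectedin_intermediate_closure_of)
  let ?S = "(\<lambda>t. Some (gauss z t)) ` {0..}"
  show "connectedin (berk_P1 w) ?S"
    by (rule connectedin_gauss_path) auto
  have S: "?S \<subseteq> topspace (berk_P1 w)"
    by (auto simp: berk_P1_def berk_A1_eq mult_seminorm_gauss)
  have "None \<in> berk_P1 w closure_of ?S"
    unfolding in_closure_of
  proof (intro conjI allI impI)
    show "None \<in> topspace (berk_P1 w)" by (simp add: berk_P1_def)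
    fix T assume "None \<in> T \<and> openin (berk_P1 w) T"
    then obtain C where C: "compactin (berk_A1 w) C" "T = insert None (Some ` (topspace (berk_A1 w) - C))"
      by (auto simp: berk_P1_def openin_Alexandroff_compactification)
    then have "compact C"
      by (simp add: berk_A1_eq compactin_subtopology)
    then have "compact ((\<lambda>x. x [:- z, 1:]) ` C)"
      by (intro compact_continuous_image continuous_intros)
    then have "bounded ((\<lambda>x. x [:- z, 1:]) ` C)"
      by (rule compact_imp_bounded)
    then obtain M where M: "\<forall>x\<in>C. \<bar>x [:- z, 1:]\<bar> \<le> M"
      unfolding bounded_iff by auto
    define t where "t = \<bar>M\<bar> + 1"
    have "gauss z t \<notin> C"
      using bspec[OF M, of "gauss z t"] by (auto simp: t_def gauss_linear)
    then have "Some (gauss z t) \<in> T"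
      by (simp add: C berk_A1_eq mult_seminorm_gauss t_def)
    then show "\<exists>y. y \<in> ?S \<and> y \<in> T"
      by (intro exI[of _ "Some (gauss z t)"]) (auto simp: t_def)
  qed
  then show "insert None ?S \<subseteq> berk_P1 w closure_of ?S"
    using closure_of_subset[OF S] by auto
qed auto

end

section \<open>Classical points of a component form a disk\<close>

locale berk_component = dense_alg_closed_subfield w \<iota>
  for w :: "'c::field \<Rightarrow> real" and \<iota> :: "'l::alg_closed_field \<Rightarrow> 'c" +
  fixes b :: 'c and r :: real and \<xi> U
  assumes r: "r \<in> w ` (UNIV - {0})"
    and \<xi>: "\<xi> = zeta w b r"
    and U: "U \<in> connected_components_of (subtopology (berk_P1 w) (topspace (berk_P1 w) - {\<xi>}))"
begin

lemma r_pos: "0 < r"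
  using r by auto

lemma \<xi>_eq: "\<xi> = Some (gauss b r)"
  using \<xi> zeta_eq_gauss[OF r] by simp

lemma connectedin_subset_component:
  assumes "connectedin (berk_P1 w) S" "\<xi> \<notin> S" "S \<inter> U \<noteq> {}"
  shows "S \<subseteq> U"
proof (rule connected_components_of_maximal[OF U])
  show "connectedin (subtopology (berk_P1 w) (topspace (berk_P1 w) - {\<xi>})) S"
    using assms connectedin_subset_topspace[OF assms(1)] by (auto simp: connectedin_subtopology)
  show "\<not> disjnt U S" using assms(3) by (auto simp: disjnt_def)
qed

text \<open>With Z equal to V closed up by \<xi>, the open disk V and the complement of Z are
  disjoint open sets that cover everything but \<xi>. A connected U meeting V lies in V.\<close>

lemma component_subset_open_disk:
  assumes c: "w (c - b) \<le> r" and cU: "type1 w (Some c) \<in> U"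
  shows "U \<subseteq> Some ` {x \<in> berk_points. x [:- c, 1:] < r}"
proof -
  define V where "V = {x \<in> berk_points. x [:- c, 1:] < r}"
  \<comment> \<open>Closed conditions for V together with \<xi>: the equations for c' on the circle
    around c exclude the open disks of radius r around these c'. Compactness makes Z closed in the
    compactification too.\<close>
  define Z where "Z = {x \<in> berk_points. x [:- c, 1:] \<le> r} \<inter>
    {x. \<forall>c'. w (c' - c) = r \<longrightarrow> x [:- c', 1:] = r}"
  have cl: "closed {x :: 'c poly \<Rightarrow> real. \<forall>c'. w (c' - c) = r \<longrightarrow> x [:- c', 1:] = r}"
    by (intro closed_Collect_all closed_Collect_imp closed_Collect_eq continuous_intros) auto
  have "compact Z"
    unfolding Z_def by (intro compact_Int_closed compact_berk_disk cl)
  moreover have "closed Z"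
    unfolding Z_def by (intro closed_Int closed_berk_disk cl)
  moreover have "Z \<subseteq> berk_points" by (auto simp: Z_def)
  ultimately have "closedin (berk_A1 w) Z"
    unfolding berk_A1_eq by (intro closed_subset)
  with \<open>compact Z\<close> \<open>Z \<subseteq> berk_points\<close> have "closedin (berk_P1 w) (Some ` Z)"
    by (simp add: berk_P1_def berk_A1_eq compactin_subtopology)
  then have out: "openin (berk_P1 w) (topspace (berk_P1 w) - Some ` Z)" by blast
  have "open {x :: 'c poly \<Rightarrow> real. x [:- c, 1:] < r}"
    by (intro open_Collect_less continuous_intros)
  then have "openin (berk_A1 w) V"
    by (auto simp: berk_A1_eq openin_subtopology V_def)
  then have inn: "openin (berk_P1 w) (Some ` V)"
    by (simp add: berk_P1_def)
  have VZ: "V \<subseteq> Z"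
  proof
    fix x assume x: "x \<in> V"
    then interpret x: mult_seminorm_over w x by unfold_locales (simp add: V_def)
    have "x [:- c', 1:] = r" if c': "w (c' - c) = r" for c'
    proof (rule antisym)
      have eq: "[:c - c':] = [:- c', 1:] + - [:- c, 1:]" by auto
      show "x [:- c', 1:] \<le> r"
        using x.sn_add_le_max[of "[:- c, 1:]" "[:c - c':]"] x c' by (simp add: V_def minus_commute)
      have "r = x [:c - c':]"
        using c' by (simp add: minus_commute)
      also have "\<dots> \<le> max (x [:- c', 1:]) (x [:- c, 1:])"
        unfolding eq using x.sn_add_le_max[of "[:- c', 1:]" "- [:- c, 1:]"] unfolding x.sn_uminus .
      finally show "r \<le> x [:- c', 1:]"
        using x by (auto simp: V_def)
    qed
    with x show "x \<in> Z" by (auto simp: V_def Z_def)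
  qed
  \<comment> \<open>By the ultrametric inequality the values at c and on that circle determine all
    values on linear polynomials, and these are the values of \<xi>.\<close>
  have ZV: "Some x = \<xi>" if "x \<in> Z" "x \<notin> V" for x
  proof -
    interpret x: mult_seminorm_over w x
      using that by unfold_locales (simp add: Z_def)
    have xc: "x [:- c, 1:] = r"
      using that by (auto simp: V_def Z_def)
    have "x [:- c', 1:] = max r (w (c' - b))" for c'
    proof -
      have "x [:- c', 1:] = max r (w (c' - c))"
      proof (cases "w (c' - c)" r rule: linorder_cases)
        case equal
        then show ?thesis using that(1) by (auto simp: Z_def)
      next
        case less
        have "x ([:- c', 1:] + [:c' - c:]) \<le> max (x [:- c', 1:]) (w (c' - c))"
          using x.sn_add_le_max[of "[:- c', 1:]" "[:c' - c:]"] by simp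
        moreover have "x ([:- c, 1:] + [:c - c':]) \<le> max (x [:- c, 1:]) (w (c' - c))"
          using x.sn_add_le_max[of "[:- c, 1:]" "[:c - c':]"] minus_commute[of c c'] by simp
        ultimately show ?thesis using less xc by (auto simp: max_def split: if_splits)
      next
        case greater
        have "x ([:- c', 1:] + - [:- c, 1:]) \<le> max (x [:- c', 1:]) (x [:- c, 1:])"
          using x.sn_add_le_max[of "[:- c', 1:]" "- [:- c, 1:]"] unfolding x.sn_uminus .
        moreover have "x ([:- c, 1:] + [:c - c':]) \<le> max (x [:- c, 1:]) (w (c' - c))"
          using x.sn_add_le_max[of "[:- c, 1:]" "[:c - c':]"] minus_commute[of c c'] by simp
        moreover have "[:- c', 1:] + - [:- c, 1:] = [:c - c':]" by simp
        ultimately show ?thesis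
          using greater xc minus_commute[of c c'] by (auto simp: max_def split: if_splits)
      qed
      \<comment> \<open>c and b are centres of the same closed disk.\<close>
      also have "max r (w (c' - c)) = max r (w (c' - b))"
        using c add_le[of "c' - c" "c - b"] diff_le[of "c' - b" "c - b"]
        by (auto simp: max_def split: if_splits)
      finally show ?thesis .
    qed
    then show ?thesis
      unfolding \<xi> by (intro seminorm_eq_zeta[OF _ _ r]) (use that in \<open>auto simp: Z_def\<close>)
  qed
  have conn: "connectedin (berk_P1 w) U" and sub: "U \<subseteq> topspace (berk_P1 w) - {\<xi>}"
    using connectedin_connected_components_of[OF U] connected_components_of_subset[OF U]
    by (auto simp: connectedin_subtopology)
  have "\<not> ((topspace (berk_P1 w) - Some ` Z) \<inter> U \<noteq> {} \<and> Some ` V \<inter> U \<noteq> {})"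
  proof
    assume "(topspace (berk_P1 w) - Some ` Z) \<inter> U \<noteq> {} \<and> Some ` V \<inter> U \<noteq> {}"
    moreover have "U \<subseteq> (topspace (berk_P1 w) - Some ` Z) \<union> Some ` V"
      using sub ZV by blast
    moreover have "(topspace (berk_P1 w) - Some ` Z) \<inter> Some ` V \<inter> U = {}"
      using VZ by blast
    ultimately show False
      using conn out inn unfolding connectedin by meson
  qed
  moreover have "Some (gauss c 0) \<in> Some ` V \<inter> U"
    using cU r_pos by (auto simp: V_def type1_Some mult_seminorm_gauss gauss_linear)
  ultimately have "(topspace (berk_P1 w) - Some ` Z) \<inter> U = {}" by auto
  then have "U \<subseteq> Some ` V"
    using sub ZV by blast
  then show ?thesis by (simp add: V_def)
qed

text \<open>The ray from z to infinity avoids \<xi>: at \<open>[:- b, 1:]\<close> its finite points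
  have values at least |z - b| > r, while \<xi> has value r.\<close>

lemma outside_disk_iff_None:
  assumes "r < w (z - b)"
  shows "type1 w (Some z) \<in> U \<longleftrightarrow> None \<in> U"
proof -
  let ?S = "insert None ((\<lambda>t. Some (gauss z t)) ` {0..})"
  have "\<xi> \<notin> ?S"
  proof
    assume "\<xi> \<in> ?S"
    then obtain t where t: "0 \<le> t" "gauss z t = gauss b r" by (auto simp: \<xi>_eq)
    have "max (w (z - b)) t = max (w (b - b)) r"
      using t(1) r_pos arg_cong[OF t(2), of "\<lambda>x. x [:- b, 1:]"] by (simp add: gauss_linear)
    then show False
      using r_pos assms by (simp add: max_def split: if_splits)
  qed
  then have "?S \<subseteq> U" if "?S \<inter> U \<noteq> {}"
    using that by (intro connectedin_subset_component connectedin_gauss_ray)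
  moreover have "None \<in> ?S" "type1 w (Some z) \<in> ?S"
    by (auto simp: type1_Some)
  ultimately show ?thesis by blast
qed

lemma type1_in_component_at_infinity_iff:
  assumes "None \<in> U"
  shows "type1 w (Some z) \<in> U \<longleftrightarrow> r < w (z - b)"
proof
  assume "type1 w (Some z) \<in> U"
  then show "r < w (z - b)"
    using component_subset_open_disk[of z] assms by force
qed (use outside_disk_iff_None assms in auto)

text \<open>That U fills the open disk comes from the segments from a and from z up to radius s = |z
  - a|. They end in the same point, as a and z are centres of the same disk, and s < r keeps them
  away from \<xi>.\<close>

lemma type1_in_disk_component_iff:
  assumes aU: "type1 w (Some a) \<in> U" and a: "w (a - b) \<le> r"
  shows "None \<notin> U" and "type1 w (Some z) \<in> U \<longleftrightarrow> w (z - a) < r"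
proof -
  have sub: "U \<subseteq> Some ` {x \<in> berk_points. x [:- a, 1:] < r}"
    using component_subset_open_disk assms by simp
  then show "None \<notin> U" by auto
  show "type1 w (Some z) \<in> U \<longleftrightarrow> w (z - a) < r"
  proof
    assume "type1 w (Some z) \<in> U"
    then have "gauss z 0 [:- a, 1:] < r"
      using sub by (auto simp: type1_Some)
    then show "w (z - a) < r" by (simp add: gauss_linear)
  next
    assume less: "w (z - a) < r"
    show "type1 w (Some z) \<in> U"
    proof (cases "z = a")
      case False
      define s where "s = w (z - a)"
      have s: "0 \<le> s" "s < r" "s \<in> w ` (UNIV - {0})"
        using less False by (auto simp: s_def)
      let ?S = "\<lambda>y. (\<lambda>t. Some (gauss y t)) ` {0..s}"
      \<comment> \<open>Tested at \<open>[:- a, 1:]\<close>: at most s on the segment, at least r at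
        \<xi>.\<close>
      have avoid: "\<xi> \<notin> ?S y" if "w (y - a) \<le> s" for y
      proof
        assume "\<xi> \<in> ?S y"
        then obtain t where t: "0 \<le> t" "t \<le> s" "gauss y t = gauss b r" by (auto simp: \<xi>_eq)
        have "max (w (y - a)) t = max (w (b - a)) r"
          using t(1) r_pos arg_cong[OF t(3), of "\<lambda>x. x [:- a, 1:]"] by (simp add: gauss_linear)
        then show False
          using t that s by (simp add: max_def split: if_splits)
      qed
      have conn: "connectedin (berk_P1 w) (?S y)" for y
        by (rule connectedin_gauss_path) auto
      have "max (w (z - c)) s = max s (w (c - a))" for c
        using add_le[of "z - a" "a - c"] diff_le[of "z - c" "z - a"] minus_commute[of a c]
        by (auto simp: s_def max_def split: if_splits)
      then have "Some (gauss z s) = zeta w a s"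
        using s by (intro seminorm_eq_zeta mult_seminorm_gauss) (auto simp: gauss_linear)
      also have "\<dots> = Some (gauss a s)"
        using s(3) by (rule zeta_eq_gauss)
      finally have meet: "Some (gauss z s) = Some (gauss a s)" .
      have "?S a \<subseteq> U"
      proof (intro connectedin_subset_component conn avoid)
        have "Some (gauss a 0) \<in> ?S a"
          using s(1) by (intro image_eqI[of _ _ 0]) auto
        moreover have "Some (gauss a 0) \<in> U"
          using aU by (simp add: type1_Some)
        ultimately show "?S a \<inter> U \<noteq> {}" by blast
      qed (use s in auto)
      moreover have "Some (gauss a s) \<in> ?S a"
        using s(1) by (intro image_eqI[of _ _ s]) auto
      ultimately have "Some (gauss z s) \<in> U"
        using meet by auto
      moreover have "Some (gauss z s) \<in> ?S z"
        using s(1) by (intro image_eqI[of _ _ s]) auto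
      ultimately have "?S z \<inter> U \<noteq> {}" by blast
      then have "?S z \<subseteq> U"
        by (intro connectedin_subset_component conn avoid) (simp_all add: s_def)
      moreover have "Some (gauss z 0) \<in> ?S z"
        using s(1) by (intro image_eqI[of _ _ 0]) auto
      ultimately show ?thesis by (auto simp only: type1_Some)
    qed (use aU in auto)
  qed
qed

end

section \<open>Fibres of rational maps\<close>

text \<open>The polynomials over K vanishing at y form an ideal, generated by a nonzero member of
  least degree. Hence coprimality over K excludes common zeros in every extension field.\<close>

lemma ex_common_divisor_of_root:
  fixes P Q :: "'k::field poly" and h :: "'k \<Rightarrow> 'b::field"
  assumes "field_embedding h" and "P \<noteq> 0 \<or> Q \<noteq> 0"
    and "poly (map_poly h P) y = 0" "poly (map_poly h Q) y = 0"
  shows "\<exists>m. m dvd P \<and> m dvd Q \<and> \<not> is_unit m"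
proof -
  interpret field_embedding h by fact
  define I where "I f \<longleftrightarrow> f \<noteq> 0 \<and> poly (map_poly h f) y = 0" for f
  have "\<exists>f. I f"
    using assms by (auto simp: I_def)
  then obtain m where m: "I m" "\<And>f. I f \<Longrightarrow> Polynomial.degree m \<le> Polynomial.degree f"
    using ex_has_least_nat[of I _ Polynomial.degree] by blast
  have "m dvd f" if "poly (map_poly h f) y = 0" for f
  proof (rule ccontr)
    assume "\<not> m dvd f"
    then have nz: "f mod m \<noteq> 0" by (simp add: dvd_eq_mod_eq_0)
    have "poly (map_poly h (f div m * m + f mod m)) y = 0"
      using that by simp
    then have "poly (map_poly h (f mod m)) y = 0"
      using m(1) by (simp only: I_def map_add map_mult poly_add poly_mult mult_zero_right add_0_left)
    then have "I (f mod m)"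
      using nz by (simp add: I_def)
    then show False
      using m nz degree_mod_less[of m f] by (fastforce simp: I_def)
  qed
  moreover have "\<not> is_unit m"
  proof
    assume "is_unit m"
    then obtain c where "m = [:c:]"
      by (auto simp: is_unit_poly_iff)
    then show False using m(1) by (auto simp: I_def)
  qed
  ultimately show ?thesis using assms by blast
qed

context field_embedding
begin

lemma rat_degree_map: "rat_degree (map_poly h P) (map_poly h Q) = rat_degree P Q"
  by (simp add: rat_degree_def)

lemma rat_map_map: "rat_map (map_poly h P) (map_poly h Q) (map_option h a) = map_option h (rat_map P Q a)"
  by (cases a) (auto simp: poly_map h_divide)

lemma fibre_poly_map: "fibre_poly (map_poly h P) (map_poly h Q) (map_option h c) = map_poly h (fibre_poly P Q c)"
  by (cases c) (auto simp: map_diff map_smult)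

text \<open>For a finite value, Q cannot vanish at y, since P would vanish there as well, against
  coprimality.\<close>

lemma rat_map_eq_of_fibre_root:
  assumes "coprime P Q" and y: "poly (map_poly h (fibre_poly P Q c)) y = 0"
  shows "rat_map (map_poly h P) (map_poly h Q) (Some y) = map_option h c"
proof (cases c)
  case None
  then show ?thesis using y by simp
next
  case (Some \<beta>)
  then have P: "poly (map_poly h P) y = h \<beta> * poly (map_poly h Q) y"
    using y by (simp add: map_diff map_smult)
  have "poly (map_poly h Q) y \<noteq> 0"
  proof
    assume Q: "poly (map_poly h Q) y = 0"
    have "P \<noteq> 0 \<or> Q \<noteq> 0" using assms(1) by auto
    then obtain m where "m dvd P" "m dvd Q" "\<not> is_unit m"
      using ex_common_divisor_of_root[OF field_embedding_axioms, of P Q y] P Q by auto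
    then show False using assms(1) by (metis coprime_common_divisor)
  qed
  then show ?thesis using P Some by simp
qed

end

text \<open>Otherwise Q = 0 or P is a multiple of Q, and coprimality leaves only constants.\<close>

lemma fibre_poly_neq_0:
  assumes "coprime P Q" "rat_degree P Q > 0"
  shows "fibre_poly P Q c \<noteq> 0"
proof
  assume 0: "fibre_poly P Q c = 0"
  have "is_unit Q \<or> Q = 0 \<and> is_unit P"
  proof (cases c)
    case None
    then show ?thesis using 0 assms(1) by simp
  next
    case (Some \<beta>)
    then have "P = Polynomial.smult \<beta> Q" using 0 by simp
    then have "Q dvd P" by (simp add: dvd_smult)
    then show ?thesis using assms(1) by (metis coprime_common_divisor dvd_refl)
  qed
  moreover have "P = Polynomial.smult \<beta> Q" if "c = Some \<beta>" for \<beta>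
    using 0 that by simp
  ultimately have "Polynomial.degree P = 0 \<and> Polynomial.degree Q = 0"
    using 0 by (cases c) (auto simp: is_unit_poly_iff)
  then show False using assms(2) by (simp add: rat_degree_def)
qed

lemma degree_fibre_poly_le: "Polynomial.degree (fibre_poly P Q c) \<le> rat_degree P Q"
  by (cases c) (auto simp: rat_degree_def intro!: degree_diff_le le_trans[OF degree_smult_le])

lemma in_simple_ext_self: "u \<in> simple_ext u"
  unfolding simple_ext_def by (rule range_eqI[of _ _ "[:0, 1:]"]) simp

lemma to_ac_in_simple_ext: "to_ac c \<in> simple_ext u"
  unfolding simple_ext_def by (rule range_eqI[of _ _ "[:c:]"]) simp

lemma is_completion_dense:
  assumes "is_completion v w \<iota>" "0 < \<epsilon>"
  shows "\<exists>y. w (z - \<iota> y) < \<epsilon>"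
proof -
  interpret nonarch_field w
    using assms by unfold_locales (simp add: is_completion_def)
  interpret Metric_space UNIV "\<lambda>x y. w (x - y)"
  proof
    show "w (x - z) \<le> w (x - y) + w (y - z)" for x y z
    proof -
      have "max (w (x - y)) (w (y - z)) \<le> w (x - y) + w (y - z)" by simp
      with add_le have "w ((x - y) + (y - z)) \<le> w (x - y) + w (y - z)"
        by (rule order_trans)
      then show ?thesis by simp
    qed
  qed (auto simp: minus_commute)
  have "z \<in> mtopology closure_of range \<iota>"
    using assms by (simp add: is_completion_def)
  then show ?thesis
    using assms(2) by (auto simp: metric_closure_of)
qed

theorem theorem3p1:
  fixes absK :: "'k::field alg_closure \<Rightarrow> real"
    and absC :: "'c::field \<Rightarrow> real"
    and \<iota> :: "'k alg_closure \<Rightarrow> 'c"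
    and P Q :: "'k poly" and PC QC :: "'c poly"
    and p d e :: nat
    and \<xi> :: "('c poly \<Rightarrow> real) option"
    and U :: "('c poly \<Rightarrow> real) option set"
  assumes "nonarch_absv absK"
    and "is_completion absK absC \<iota>"
    and "p = residue_char (\<lambda>x::'k. absK (to_ac x))"
    and "coprime P Q"
    and "d = rat_degree P Q"
    and "d \<ge> 2"
    and "PC = map_poly (\<lambda>x. \<iota> (to_ac x)) P"
    and "QC = map_poly (\<lambda>x. \<iota> (to_ac x)) Q"
    and "type_II absC \<xi>"
    and "totally_invariant absC PC QC \<xi>"
    and "e = vp p (d - 1)"
    and "indifferent_component absC PC QC \<xi> U"
    and "\<exists>a :: 'k option. type1 absC (map_option (\<lambda>x. \<iota> (to_ac x)) a) \<in> U"
  shows "\<exists>\<alpha> :: 'k alg_closure option.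
           type1 absC (map_option \<iota> \<alpha>) \<notin> U \<and> ext_degree \<alpha> \<le> p ^ e"
proof -
  obtain b r where r: "r \<in> absC ` (UNIV - {0})" and \<xi>: "\<xi> = zeta absC b r"
    using assms(9) by (auto simp: type_II_def)
  have U: "U \<in> connected_components_of (subtopology (berk_P1 absC) (topspace (berk_P1 absC) - {\<xi>}))"
    and inj: "inj_on (berk_map absC PC QC) U"
    and mult_1: "\<And>a. type1 absC a \<in> U \<Longrightarrow> rat_mult PC QC a = 1"
    using assms(12) by (auto simp: indifferent_component_def fixed_component_def)
  have abs_\<iota>: "absC (\<iota> x) = absK x" for x
    using assms(2) by (simp add: is_completion_def)
  interpret K: nonarch_field absK by standard fact
  interpret berk_component absC \<iota> b r \<xi> U
    using assms(2) is_completion_dense[OF assms(2)] r \<xi> U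
    by unfold_locales (auto simp: is_completion_def)
  define h :: "'k \<Rightarrow> 'c" where "h = (\<lambda>x. \<iota> (to_ac x))"
  have h_embedding: "field_embedding h"
    by standard (auto simp: h_def h_add h_mult)
  interpret h: field_embedding h by (rule h_embedding)
  have PC: "PC = map_poly h P" "QC = map_poly h Q"
    using assms(7,8) by (simp_all add: h_def)
  have map_h: "map_poly h f = map_poly \<iota> (map_poly to_ac f)" for f
    by (rule poly_eqI, simp, simp add: h_def)
  have map_option_h: "map_option (\<lambda>x. \<iota> (to_ac x)) a = map_option h a" for a
    by (simp add: h_def)

  \<comment> \<open>Injectivity on U reaches classical points through \<open>berk_map_type1\<close>;
    the fibre equation is solved in the closure of K and compared in C.\<close>
  have fibre: "type1 absC (Some (\<iota> y)) \<notin> U"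
    if a: "type1 absC (map_option h a) \<in> U" and ya: "Some y \<noteq> map_option to_ac a"
      and y: "poly (map_poly to_ac (fibre_poly P Q (rat_map P Q a))) y = 0" for a y
  proof
    assume yU: "type1 absC (Some (\<iota> y)) \<in> U"
    have "poly (map_poly h (fibre_poly P Q (rat_map P Q a))) (\<iota> y) = 0"
      using y by (simp add: map_h poly_map)
    then have "rat_map PC QC (Some (\<iota> y)) = rat_map PC QC (map_option h a)"
      using h.rat_map_eq_of_fibre_root[OF \<open>coprime P Q\<close>] by (simp only: PC h.rat_map_map)
    then have "type1 absC (Some (\<iota> y)) = type1 absC (map_option h a)"
      using yU a inj by (metis berk_map_type1[OF nonarch] inj_onD)
    then have "Some (\<iota> y) = map_option h a"
      by (simp only: type1_eq_iff)
    then show False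
      using ya by (cases a) (auto simp: h_def)
  qed
  have fibre_map: "fibre_poly PC QC (rat_map PC QC (map_option h a)) =
      map_poly h (fibre_poly P Q (rat_map P Q a))" for a
    by (simp only: PC h.rat_map_map h.fibre_poly_map)
  have mult_fibre: "rat_mult PC QC (map_option h a) =
      (case a of None \<Rightarrow> d - Polynomial.degree (fibre_poly P Q (rat_map P Q a))
       | Some c \<Rightarrow> Polynomial.order (h c) (map_poly h (fibre_poly P Q (rat_map P Q a))))" for a
    unfolding rat_mult_def Let_def fibre_map
    by (cases a) (simp_all add: PC h.rat_degree_map assms(5) del: rat_map.simps fibre_poly.simps)
  show ?thesis
  proof (cases "None \<in> U")
    case True
    \<comment> \<open>Infinity itself serves as the rational point a, so z is already the right
      coordinate and F plays the role of G. The multiplicity of infinity is the drop from d to the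
      degree of F, hence that drop is 1.\<close>
    define F where "F = fibre_poly P Q (rat_map P Q None)"
    have "type1 absC (map_option h None) \<in> U" using True by simp
    note fibreF = fibre[OF this, folded F_def]
    have "d - Polynomial.degree F = 1"
      using mult_1[of None] mult_fibre[of None] True by (simp add: F_def)
    then have degF: "d - 1 = Polynomial.degree F" using assms(6) by simp
    \<comment> \<open>The centre b lies in C; the root estimate takes place in the closure of K, so
      b is replaced by another centre of the same disk.\<close>
    obtain b' where b': "absC (b - \<iota> b') < r" using dense[OF r_pos] by blast
    have near: "absK (u - b') \<le> r \<longleftrightarrow> type1 absC (Some (\<iota> u)) \<notin> U" for u
      using type1_in_component_at_infinity_iff[OF True, of "\<iota> u"] b'
        add_le[of "\<iota> u - b" "b - \<iota> b'"] diff_le[of "\<iota> u - \<iota> b'" "b - \<iota> b'"]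
      by (auto simp: h_diff max_def simp flip: abs_\<iota> split: if_splits)
    obtain u H where u: "absK (u - b') \<le> r" and H: "H \<noteq> 0" "Polynomial.degree H \<le> p ^ vp p (d - 1)"
      "poly (map_poly to_ac (H :: 'k poly)) u = 0"
      using exists_root_in_disk[OF assms(1,3) degF, of b' r] assms(6) fibreF near by auto
    have "ext_degree (Some u) \<le> Polynomial.degree H"
      using H by (intro ext_degree_le) (auto simp: in_simple_ext_self)
    then show ?thesis
      using u near[of u] H(2) assms(11) by (intro exI[of _ "Some u"]) auto
  next
    case False
    obtain a0 :: 'k where a0: "type1 absC (Some (h a0)) \<in> U"
    proof -
      obtain a where a: "type1 absC (map_option h a) \<in> U"
        using assms(13) by (auto simp: map_option_h)
      with False show ?thesis using that by (cases a) auto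
    qed
    \<comment> \<open>Were a0 outside the closed disk, its component would contain infinity.\<close>
    have a0b: "absC (h a0 - b) \<le> r"
      using outside_disk_iff_None[of "h a0"] a0 False by linarith
    note U_iff = type1_in_disk_component_iff[OF a0 a0b]
    define F where "F = fibre_poly P Q (rat_map P Q (Some a0))"
    have "type1 absC (map_option h (Some a0)) \<in> U" using a0 by simp
    note fibreF = fibre[OF this, folded F_def]
    have F0: "F \<noteq> 0"
      unfolding F_def by (rule fibre_poly_neq_0) (use assms(4-6) in auto)
    have order_F: "Polynomial.order (h a0) (map_poly h F) = 1"
      using mult_1[OF a0] mult_fibre[of "Some a0"] by (simp add: F_def del: rat_map.simps)
    then have "poly (map_poly h F) (h a0) = 0"
      using F0 by (simp add: order_root)
    then have "poly F a0 = 0" by (simp add: h.poly_map)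
    then obtain F1 where F1: "F = [:- a0, 1:] * F1"
      by (metis dvdE poly_eq_0_iff_dvd)
    have "F1 \<noteq> 0" using F0 F1 by auto
    \<comment> \<open>Multiplicity one: a single division by z - a0 removes this point from the
      fibre entirely.\<close>
    have F1_a0: "poly F1 a0 \<noteq> 0"
    proof
      assume "poly F1 a0 = 0"
      then obtain F2 where "F1 = [:- a0, 1:] * F2"
        by (metis dvdE poly_eq_0_iff_dvd)
      then have "map_poly h F = [:- h a0, 1:] ^ 2 * map_poly h F2"
        unfolding F1 by (simp only: h.map_mult power2_eq_square mult.assoc) (simp only: h.map_pCons h.h_uminus h.h_one map_poly_0)
      then have "[:- h a0, 1:] ^ 2 dvd map_poly h F" by (rule dvdI)
      then have "2 \<le> Polynomial.order (h a0) (map_poly h F)"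
        using F0 by (simp only: order_divides h.map_eq_0_iff simp_thms)
      then show False using order_F by simp
    qed
    \<comment> \<open>The inequality is strict exactly when infinity belongs to the fibre.\<close>
    have degF1: "Polynomial.degree F1 \<le> d - 1"
    proof -
      have "Polynomial.degree F = Suc (Polynomial.degree F1)"
        using \<open>F1 \<noteq> 0\<close> unfolding F1 by (subst degree_mult_eq) auto
      then show ?thesis
        using degree_fibre_poly_le[of P Q "rat_map P Q (Some a0)"] assms(5)
        by (simp add: F_def del: rat_map.simps)
    qed
    \<comment> \<open>In the coordinate u = 1/(z - a0) this is u^(d - 1) F1(a0 + 1/u). The monomial
      restores the fibre points at infinity as zeros at u = 0.\<close>
    define G where "G = Polynomial.monom 1 (d - 1 - Polynomial.degree F1) *
      reflect_poly (pcompose F1 [:a0, 1:])"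
    \<comment> \<open>The constant term is F1(a0); being nonzero, it preserves the degree under
      \<open>reflect_poly\<close>.\<close>
    have E: "Polynomial.coeff (pcompose F1 [:a0, 1:]) 0 \<noteq> 0"
      using F1_a0 by (simp add: poly_pcompose flip: poly_0_coeff_0)
    have degG: "d - 1 = Polynomial.degree G"
    proof -
      have "pcompose F1 [:a0, 1:] \<noteq> 0" using E by (metis coeff_0)
      then have "Polynomial.degree G = d - 1 - Polynomial.degree F1 + Polynomial.degree F1"
        using E unfolding G_def by (subst degree_mult_eq) (auto simp: degree_monom_eq degree_pcompose)
      then show ?thesis using degF1 by simp
    qed
    \<comment> \<open>The complement of U, consisting of infinity and the z with |z - a0| \<ge> r,
      is the closed disk |u| \<le> 1/r.\<close>
    have inverse_iff: "r \<le> absK (inverse u) \<longleftrightarrow> absK (u - 0) \<le> inverse r" if "u \<noteq> 0" for u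
      using r_pos K.pos_iff[of u] that unfolding K.inverse diff_zero
      by (auto simp: field_simps simp del: K.pos_iff)
    have rootG: "absK (u - 0) \<le> inverse r" if u: "poly (map_poly to_ac G) u = 0" for u
    proof (cases "u = 0")
      case u0: False
      define y where "y = to_ac a0 + inverse u"
      have "poly (map_poly to_ac F1) y = 0"
        using u u0 by (simp add: G_def y_def to_ac.map_mult to_ac.map_monom to_ac.map_reflect
            to_ac.map_pcompose poly_monom poly_reflect_poly_nz poly_pcompose)
      then have "poly (map_poly to_ac F) y = 0"
        unfolding F1 by (simp only: to_ac.map_mult poly_mult mult_zero_right)
      then have "type1 absC (Some (\<iota> y)) \<notin> U"
        using fibreF[of y] u0 by (simp add: y_def)
      then have "r \<le> absK (inverse u)"
        by (simp add: U_iff y_def h_def h_add abs_\<iota>)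
      then show ?thesis
        using inverse_iff[OF u0] by simp
    qed (use r_pos in simp)
    obtain u H where u: "absK (u - 0) \<le> inverse r" and H: "H \<noteq> 0" "Polynomial.degree H \<le> p ^ vp p (d - 1)"
      "poly (map_poly to_ac (H :: 'k poly)) u = 0"
      using exists_root_in_disk[OF assms(1,3) degG, of 0 "inverse r"] assms(6) rootG by auto
    \<comment> \<open>Back to the coordinate z, where u = 0 is infinity. In either case K(\<alpha>)
      is contained in K(u).\<close>
    define \<alpha> where "\<alpha> = (if u = 0 then None else Some (to_ac a0 + inverse u))"
    have "type1 absC (map_option \<iota> \<alpha>) \<notin> U"
    proof (cases "u = 0")
      case False
      then have "r \<le> absK (inverse u)"
        using u inverse_iff by simp
      then show ?thesis
        using False by (simp add: \<alpha>_def U_iff h_def h_add abs_\<iota>)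
    qed (simp add: \<alpha>_def U_iff)
    moreover have "ext_degree \<alpha> \<le> Polynomial.degree H"
      using H is_subfield_simple_ext[of u] in_simple_ext_self[of u] to_ac_in_simple_ext[of a0 u]
      by (intro ext_degree_le[of H u]) (auto simp: \<alpha>_def is_subfield_def)
    ultimately show ?thesis
      using H(2) assms(11) by (intro exI[of _ \<alpha>]) auto
  qed
qed

end
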